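(* Let $Q$ be a spider web quiver with three circles and middle circle vertices $1,\dots,n$, carrying $y$-variables $y_v$, and set $y_0:=1$. For each outer vertex $i^-$ connected to the middle circle let $d_i$ (resp. $e_i$) be the minimal (resp. maximal) $j$ such that $i^-$ is connected to $j$; for each inner vertex $i^+$ connected to the middle circle let $f_i$ (resp. $g_i$) be the minimal (resp. maximal) such $j$. Applying $\tau=\mu_1\cdots\mu_{n-2}s_{n-1,n}\mu_n\cdots\mu_1$ yields the following $y$-variables $y'$: (1) If $1\le i\le n-1$, $$y_i'=\frac{\sum_{j=i}^{n}\prod_{k=i}^{j-1}y_k+\left(\prod_{k=i}^n y_k\right)\left(\sum_{j=0}^{i-2}\prod_{k=0}^j y_k\right)}{\sum_{j=i+1}^{n-1}\prod_{k=i+1}^{j}y_k+\left(\prod_{k=i+1}^n y_k\right)\left(\sum_{j=0}^{i}\prod_{k=0}^j y_k\right)}.$$ (2) $$y_n'=\frac{1+y_n\sum_{j=0}^{n-2}\prod_{k=0}^j y_k}{\sum_{j=1}^{n-1}\prod_{k=1}^j y_k+\prod_{k=1}^n y_k}.$$ (3) If there are no edges between $i^-$ and the middle circle, $y_{i^-}'=y_{i^-}$. (4) If $i$ is maximal such that there are edges between $i^-$ and the middle circle, $$y_{i^-}'=y_{i^-}\frac{\left(\prod_{k=e_i+1}^n y_k\right)\left(\sum_{j=d_1}^{n-1}\prod_{k=0}^j y_k+\left(\prod_{k=0}^n y_k\right)\left(\sum_{j=0}^{d_1-1}\prod_{k=0}^j y_k\right)\right)}{\sum_{j=e_i+1}^n\prod_{k=e_i+1}^{j-1}y_k+\left(\prod_{k=e_i+1}^n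 y_k\right)\left(\sum_{j=0}^{e_i-1}\prod_{k=0}^j y_k\right)}.$$ (5) Otherwise, $$y_{i^-}'=y_{i^-}\frac{\sum_{j=e_i}^{n-1}\prod_{k=d_i+1}^j y_k+\left(\prod_{k=d_i+1}^n y_k\right)\left(\sum_{j=0}^{e_i-1}\prod_{k=0}^j y_k\right)}{\sum_{j=d_i+1}^n\prod_{k=d_i+1}^{j-1}y_k+\left(\prod_{k=d_i+1}^n y_k\right)\left(\sum_{j=0}^{d_i-1}\prod_{k=0}^j y_k\right)}.$$ (6) If there are no edges between $i^+$ and the middle circle, $y_{i^+}'=y_{i^+}$. (7) If $i$ is maximal such that there are edges between $i^+$ and the middle circle, $$y_{i^+}'=y_{i^+}\frac{\left(\prod_{k=g_i+1}^n y_k\right)\left(\sum_{j=f_1}^{n-1}\prod_{k=0}^j y_k+\left(\prod_{k=0}^n y_k\right)\left(\sum_{j=0}^{f_1-1}\prod_{k=0}^j y_k\right)\right)}{\sum_{j=g_i+1}^n\prod_{k=g_i+1}^{j-1}y_k+\left(\prod_{k=g_i+1}^n y_k\right)\left(\sum_{j=0}^{g_i-1}\prod_{k=0}^j y_k\right)}.$$ (8) Otherwise, $$y_{i^+}'=y_{i^+}\frac{\sum_{j=g_i}^{n-1}\prod_{k=f_i+1}^j y_k+\left(\prod_{k=f_i+1}^n y_k\right)\left(\sum_{j=0}^{g_i-1}\prod_{k=0}^j y_k\right)}{\sum_{j=f_i+1}^n\prod_{k=f_i+1}^{j-1}y_k+\left(\prod_{k=f_i+1}^n y_k\right)\left(\sum_{j=0}^{f_i-1}\prod_{k=0}^j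 y_k\right)}.$$
   Context: Quiver: directed graph with no loops or 2-cycles. Mutation $\mu_k$ of a $y$-seed $(Q,\mathbf y)$: the quiver is mutated at $k$ (add $i\to j$ for each $i\to k\to j$, reverse arrows at $k$, remove 2-cycles) and $y_k'=y_k^{-1}$; for $i\ne k$, $y_i'=y_i(1+y_k^{-1})^{-m}$ if there are $m$ arrows $k\to i$, and $y_i'=y_i(1+y_k)^{m}$ if there are $m$ arrows $i\to k$. $s_{n-1,n}$ transposes vertices $n-1$ and $n$; $\tau$ is applied rightmost first. Spider web quiver: three concentric circles, at least 2 vertices on each, circle edges oriented counterclockwise, arrows between adjacent circles such that each face is a directed cycle with exactly two arrows between circles and at least 3 sides. Middle circle vertices labeled $1,\dots,n$ following the arrows. If $i$ is the lowest-index middle vertex with an edge to the outer circle, the outer vertex with an arrow to $i$ is $1^-$, and the outer circle continues $2^-,3^-,\dots$ following the arrows; the inner circle is labeled $1^+,2^+,\dots$ in the same way using the lowest-index middle vertex with an edge to the inner circle. Empty sums are 0 and empty products are 1. *)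

theory Defs
  imports Complex_Main "HOL-Library.Multiset" "HOL-Combinatorics.Transposition"
begin

section \<open>Quivers and \<open>y\<close>-seeds\<close>

text \<open>\<open>Q u v\<close> is the number of arrows from \<open>u\<close> to \<open>v\<close>.\<close>

type_synonym 'v quiver = "'v \<Rightarrow> 'v \<Rightarrow> nat"

type_synonym ('v, 'a) seed = "'v quiver \<times> ('v \<Rightarrow> 'a)"

text \<open>The subtraction is truncated. A loop counts as its own reversal and is removed as well;
  no loop ever arises below.\<close>

definition remove_2cycles :: "'v quiver \<Rightarrow> 'v quiver" where
  "remove_2cycles A = (\<lambda>u v. A u v - A v u)"

definition mutate_quiver :: "'v \<Rightarrow> 'v quiver \<Rightarrow> 'v quiver" where
  "mutate_quiver k Q = remove_2cycles
     (\<lambda>i j. if i = k \<or> j = k then Q j i else Q i j + Q i k * Q k j)"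

definition mutate_vars :: "'v \<Rightarrow> 'v quiver \<Rightarrow> ('v \<Rightarrow> 'a::field) \<Rightarrow> 'v \<Rightarrow> 'a" where
  "mutate_vars k Q y = (\<lambda>i.
     if i = k then inverse (y k)
     else if Q k i > 0 then y i * (1 + inverse (y k)) powi (- int (Q k i))
     else y i * (1 + y k) ^ Q i k)"

definition mutate :: "'v \<Rightarrow> ('v, 'a::field) seed \<Rightarrow> ('v, 'a) seed" where
  "mutate k s = (mutate_quiver k (fst s), mutate_vars k (fst s) (snd s))"

definition swap_vertices :: "'v \<Rightarrow> 'v \<Rightarrow> ('v, 'a) seed \<Rightarrow> ('v, 'a) seed" where
  "swap_vertices u v s =
     ((\<lambda>i j. fst s (Transposition.transpose u v i) (Transposition.transpose u v j)),
      (\<lambda>i. snd s (Transposition.transpose u v i)))"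

text \<open>The \<open>y\<close>-variables live in a semifield \<open>P\<close> inside a field. For independent variables, \<open>P\<close> is
  the set of nonzero subtraction-free rational functions in them; another instance is the set of
  positive reals. Elements of \<open>P\<close> can be added, multiplied and divided without leaving \<open>P\<close>, so
  no denominator met under mutation vanishes.\<close>

definition semifield_in :: "'a::field set \<Rightarrow> bool" where
  "semifield_in P \<longleftrightarrow> 0 \<notin> P \<and> 1 \<in> P \<and>
     (\<forall>x\<in>P. \<forall>y\<in>P. x + y \<in> P \<and> x * y \<in> P) \<and> (\<forall>x\<in>P. inverse x \<in> P)"


section \<open>Spider web quivers with three circles\<close>

text \<open>\<open>Mid j\<close>, \<open>Outer i\<close>, \<open>Inner i\<close> are the vertices written \<open>j\<close>, \<open>i\<^sup>-\<close>, \<open>i\<^sup>+\<close>; all labels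
  start at 1.\<close>

datatype vertex = Mid nat | Outer nat | Inner nat

text \<open>Walking counterclockwise along a circle with \<open>N\<close> vertices passes \<open>pos N C 0\<close>,
  \<open>pos N C 1\<close>, \<open>\<dots>\<close>, which is \<open>N\<close>-periodic; position 0 carries the label 1.\<close>

definition pos :: "nat \<Rightarrow> (nat \<Rightarrow> vertex) \<Rightarrow> nat \<Rightarrow> vertex" where
  "pos N C p = C (p mod N + 1)"

text \<open>The arrows of the circle along the walk from position \<open>p\<close> to position \<open>q\<close>.\<close>

definition arc :: "nat \<Rightarrow> (nat \<Rightarrow> vertex) \<Rightarrow> nat \<Rightarrow> nat \<Rightarrow> (vertex \<times> vertex) multiset" where
  "arc N C p q = image_mset (\<lambda>r. (pos N C r, pos N C (Suc r))) (mset_set {p..<q})"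

definition directed_cycle :: "('v \<times> 'v) multiset \<Rightarrow> bool" where
  "directed_cycle F \<longleftrightarrow> (\<exists>vs. vs \<noteq> [] \<and> distinct vs \<and> F = mset (zip vs (rotate1 vs)))"

text \<open>\<open>annulus N A M B S\<close>: \<open>S\<close> is the multiset of arrows drawn without crossings in the annulus
  between a circle \<open>A\<close> with \<open>N\<close> vertices and a circle \<open>B\<close> with \<open>M\<close> vertices, subject to the
  condition on faces. There are \<open>L\<close> such arrows, numbered counterclockwise; the \<open>k\<close>-th joins
  position \<open>a k\<close> of \<open>A\<close> and position \<open>b k\<close> of \<open>B\<close>, and points towards \<open>B\<close> iff \<open>to_B k\<close>.
  Non-crossing means that \<open>a\<close> and \<open>b\<close> are nondecreasing and both go around exactly once
  before the initial arrow is reached again (as number \<open>L\<close>). The faces are the regions between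
  consecutive arrows; a region bounded twice by the same arrow (\<open>L = 1\<close>) is not a directed cycle.\<close>

definition spoke :: "nat \<Rightarrow> (nat \<Rightarrow> vertex) \<Rightarrow> nat \<Rightarrow> (nat \<Rightarrow> vertex) \<Rightarrow>
    (nat \<Rightarrow> nat) \<Rightarrow> (nat \<Rightarrow> nat) \<Rightarrow> (nat \<Rightarrow> bool) \<Rightarrow> nat \<Rightarrow> vertex \<times> vertex" where
  "spoke N A M B a b to_B k =
     (if to_B k then (pos N A (a k), pos M B (b k)) else (pos M B (b k), pos N A (a k)))"

definition face :: "nat \<Rightarrow> (nat \<Rightarrow> vertex) \<Rightarrow> nat \<Rightarrow> (nat \<Rightarrow> vertex) \<Rightarrow>
    (nat \<Rightarrow> nat) \<Rightarrow> (nat \<Rightarrow> nat) \<Rightarrow> (nat \<Rightarrow> bool) \<Rightarrow> nat \<Rightarrow> (vertex \<times> vertex) multiset" where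
  "face N A M B a b to_B k =
     {# spoke N A M B a b to_B k, spoke N A M B a b to_B (Suc k) #}
     + arc N A (a k) (a (Suc k)) + arc M B (b k) (b (Suc k))"

definition annulus :: "nat \<Rightarrow> (nat \<Rightarrow> vertex) \<Rightarrow> nat \<Rightarrow> (nat \<Rightarrow> vertex) \<Rightarrow>
    (vertex \<times> vertex) multiset \<Rightarrow> bool" where
  "annulus N A M B S \<longleftrightarrow> (\<exists>L a b to_B. L > 0 \<and>
     (\<forall>k<L. a k \<le> a (Suc k) \<and> b k \<le> b (Suc k)) \<and>
     a L = a 0 + N \<and> b L = b 0 + M \<and> to_B L = to_B 0 \<and>
     (\<forall>k<L. directed_cycle (face N A M B a b to_B k) \<and> size (face N A M B a b to_B k) \<ge> 3) \<and>
     S = image_mset (spoke N A M B a b to_B) (mset_set {0..<L}))"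

text \<open>The indices of the middle vertices connected to \<open>v\<close>.\<close>

definition mid_nbrs :: "nat \<Rightarrow> vertex quiver \<Rightarrow> vertex \<Rightarrow> nat set" where
  "mid_nbrs n Q v = {j \<in> {1..n}. Q v (Mid j) > 0 \<or> Q (Mid j) v > 0}"

text \<open>The circles have \<open>N\<close> (outer), \<open>n\<close> (middle) and \<open>M\<close> (inner) vertices. A circle with exactly
  two vertices is drawn with a pair of opposite arrows; this 2-cycle bounds faces of the drawing
  but is cancelled in the quiver. The last two conditions fix the labels \<open>1\<^sup>-\<close> and \<open>1\<^sup>+\<close>.\<close>

definition spider_web :: "nat \<Rightarrow> nat \<Rightarrow> nat \<Rightarrow> vertex quiver \<Rightarrow> bool" where
  "spider_web N n M Q \<longleftrightarrow> N \<ge> 2 \<and> n \<ge> 2 \<and> M \<ge> 2 \<and>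
     (\<exists>S T. annulus N Outer n Mid S \<and> annulus n Mid M Inner T \<and>
        Q = remove_2cycles (\<lambda>u v. count
              (arc N Outer 0 N + arc n Mid 0 n + arc M Inner 0 M + S + T) (u, v))) \<and>
     Q (Outer 1) (Mid (Min (\<Union>i\<in>{1..N}. mid_nbrs n Q (Outer i)))) > 0 \<and>
     Q (Inner 1) (Mid (Min (\<Union>i\<in>{1..M}. mid_nbrs n Q (Inner i)))) > 0"

definition web_vertices :: "nat \<Rightarrow> nat \<Rightarrow> nat \<Rightarrow> vertex set" where
  "web_vertices N n M = Outer ` {1..N} \<union> Mid ` {1..n} \<union> Inner ` {1..M}"

text \<open>The composition is applied rightmost first: \<open>\<mu>\<^sub>1, \<dots>, \<mu>\<^sub>n\<close>, then the transposition, then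
  \<open>\<mu>\<close> at the vertices \<open>n - 2, \<dots>, 1\<close>.\<close>

definition tau :: "nat \<Rightarrow> (vertex, 'a::field) seed \<Rightarrow> (vertex, 'a) seed" where
  "tau n s = fold (\<lambda>k. mutate (Mid k)) (rev [1..<n - 1])
     (swap_vertices (Mid (n - 1)) (Mid n)
       (fold (\<lambda>k. mutate (Mid k)) [1..<n + 1] s))"

text \<open>The variables of the middle circle, with \<open>y\<^sub>0 = 1\<close>.\<close>

definition mid_var :: "(vertex \<Rightarrow> 'a::field) \<Rightarrow> nat \<Rightarrow> 'a" where
  "mid_var y k = (if k = 0 then 1 else y (Mid k))"

end

theory Submission
  imports Defs
begin

text \<open>Mutations at middle vertices see another vertex only through its arrows to the middle circle.
  Mutating at \<open>1, \<dots>, n - 2\<close> shrinks the middle cycle until a quiver of type \<open>D\<^sub>n\<close> remains, in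
  which \<open>n - 1\<close> and \<open>n\<close> are interchangeable up to orientation. Mutating at both and exchanging
  them restores the quiver, so the remaining mutations undo the first ones on the level of quivers.
  Hence a vertex \<open>v\<close> meets each \<open>k < n\<close> twice, with opposite numbers \<open>u\<^sub>k\<close> and \<open>- u\<^sub>k\<close> of arrows to
  \<open>k\<close> and with explicitly known middle variables, and its variable is multiplied by a product of
  factors depending only on \<open>u\<^sub>k\<close>. In a spider web the faces force the arrows between two circles
  to zigzag, so \<open>v\<close> has one arrow to \<open>p\<close> and one from \<open>q\<close>. If \<open>p < q\<close>, then \<open>u\<^sub>k = 1\<close> exactly for
  \<open>p \<le> k < q\<close>, and the product telescopes; the vertex with \<open>q < p\<close> has \<open>u\<^sub>k = 1\<close> for \<open>p \<le> k < n\<close>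
  and \<open>u\<^sub>q = - 1\<close>.\<close>

section \<open>Signed quivers\<close>

text \<open>In a reduced quiver the signed count recovers both arrow numbers, and in these terms
  mutation only adds a correction.\<close>

definition arrows :: "'v quiver \<Rightarrow> 'v \<Rightarrow> 'v \<Rightarrow> int" where
  "arrows Q u v = int (Q u v) - int (Q v u)"

definition reduced :: "'v quiver \<Rightarrow> bool" where
  "reduced Q \<longleftrightarrow> (\<forall>u v. Q u v = 0 \<or> Q v u = 0)"

text \<open>The signed number of paths \<open>i \<rightarrow> k \<rightarrow> j\<close> that mutation at \<open>k\<close> turns into arrows \<open>i \<rightarrow> j\<close>,
  where \<open>a\<close> and \<open>b\<close> count the arrows from \<open>i\<close> and from \<open>j\<close> to \<open>k\<close>.\<close>

definition pass :: "int \<Rightarrow> int \<Rightarrow> int" where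
  "pass a b = max 0 a * max 0 (- b) - max 0 b * max 0 (- a)"

text \<open>This is the factor that mutation at \<open>k\<close> applies to a variable with
  \<open>c\<close> signed arrows to \<open>k\<close>, where \<open>x\<close> is the variable at
  \<open>k\<close>; both directions of arrows become one function.\<close>

definition ymult :: "int \<Rightarrow> 'a::field \<Rightarrow> 'a" where
  "ymult c x = (if c < 0 then (1 + inverse x) powi c else (1 + x) ^ nat c)"

lemma arrows_anti: "arrows Q v u = - arrows Q u v"
  by (simp add: arrows_def)

lemma reducedD:
  assumes "reduced Q"
  shows "int (Q u v) = max 0 (arrows Q u v)"
  using assms[unfolded reduced_def, rule_format, of u v] by (auto simp: arrows_def)

lemma reduced_remove_2cycles [simp]: "reduced (remove_2cycles A)"
  by (auto simp: reduced_def remove_2cycles_def)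

lemma arrows_remove_2cycles: "arrows (remove_2cycles A) u v = int (A u v) - int (A v u)"
  by (simp add: arrows_def remove_2cycles_def)

lemma reduced_mutate_quiver [simp]: "reduced (mutate_quiver k Q)"
  by (simp add: mutate_quiver_def)

text \<open>Removing 2-cycles preserves signed counts, so away from \<open>k\<close> only the
  composed paths through \<open>k\<close> contribute.\<close>

lemma arrows_mutate_quiver:
  assumes "reduced Q"
  shows "arrows (mutate_quiver k Q) i j =
    (if i = k \<or> j = k then - arrows Q i j
     else arrows Q i j + pass (arrows Q i k) (arrows Q j k))"
proof (cases "i = k \<or> j = k")
  case True
  then show ?thesis
    unfolding mutate_quiver_def arrows_remove_2cycles by (auto simp: arrows_def)
next
  case False
  then have "arrows (mutate_quiver k Q) i j =
      int (Q i j) + int (Q i k) * int (Q k j) - (int (Q j i) + int (Q j k) * int (Q k i))"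
    by (simp add: mutate_quiver_def arrows_remove_2cycles)
  then show ?thesis
    using False
    by (simp add: reducedD[OF assms] arrows_anti[of Q k] pass_def arrows_anti[of Q j i])
qed

lemma mutate_vars_ymult:
  assumes "reduced Q"
  shows "mutate_vars k Q y i = (if i = k then inverse (y k) else y i * ymult (arrows Q i k) (y k))"
proof -
  have "Q k i > 0 \<longleftrightarrow> arrows Q i k < 0" "Q k i > 0 \<Longrightarrow> - int (Q k i) = arrows Q i k"
    "\<not> Q k i > 0 \<Longrightarrow> Q i k = nat (arrows Q i k)"
    using assms[unfolded reduced_def, rule_format, of i k] by (auto simp: arrows_def)
  then show ?thesis
    by (auto simp: mutate_vars_def ymult_def)
qed

lemma ymult_0 [simp]: "ymult 0 x = 1"
  and ymult_1: "ymult 1 x = 1 + x"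
  by (simp_all add: ymult_def)

lemma ymult_minus_1: "x \<noteq> 0 \<Longrightarrow> ymult (-1) (x::'a::field) = x / (1 + x)"
  by (auto simp: ymult_def power_int_minus field_simps)

text \<open>The middle quiver after mutation at \<open>1, \<dots>, t\<close> for \<open>t \<le> n - 2\<close>: the cycle \<open>t + 1, \<dots>, n\<close>, the
  triangle \<open>t, n, t + 1\<close> and the path \<open>1, \<dots>, t\<close>. For \<open>t = n - 2\<close> the two arrows between \<open>n - 1\<close>
  and \<open>n\<close> cancel. There is no vertex 0, so \<open>t = 0\<close> gives the original cycle.\<close>

definition mid_arrow :: "nat \<Rightarrow> nat \<Rightarrow> nat \<Rightarrow> nat \<Rightarrow> int" where
  "mid_arrow n t i j =
     of_bool (j = Suc i \<and> i \<noteq> t) + of_bool (i = t \<and> j = n)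
     + of_bool (i = Suc t \<and> j = t) + of_bool (i = n \<and> j = Suc t)"

definition mid_quiver :: "nat \<Rightarrow> nat \<Rightarrow> nat \<Rightarrow> nat \<Rightarrow> int" where
  "mid_quiver n t i j = mid_arrow n t i j - mid_arrow n t j i"

lemma mid_quiver_col:
  assumes "Suc t < n - 1" "1 \<le> i" "i \<le> n"
  shows "mid_quiver n t i (Suc t) = of_bool (i = n) - of_bool (i = t) - of_bool (i = t + 2)"
  using assms unfolding mid_quiver_def mid_arrow_def by auto

lemma mid_quiver_anti: "mid_quiver n t j i = - mid_quiver n t i j"
  unfolding mid_quiver_def by (rule minus_diff_eq[symmetric])

lemma mid_quiver_col_after:
  assumes "Suc t < n - 1" "1 \<le> i" "i \<le> n"
  shows "mid_quiver n (Suc t) i (Suc t) = of_bool (i = t) + of_bool (i = t + 2) - of_bool (i = n)"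
  using assms unfolding mid_quiver_def mid_arrow_def by auto

text \<open>Mutation creates \<open>n -> t\<close> and \<open>n -> t + 2\<close>. The first cancels
  \<open>t -> n\<close>, which is therefore added on the left.\<close>

lemma mid_arrow_step:
  assumes "Suc t < n - 1" "i \<noteq> Suc t" "j \<noteq> Suc t"
  shows "mid_arrow n (Suc t) i j + of_bool (i = t \<and> j = n) =
    mid_arrow n t i j + of_bool (i = n \<and> j = t + 2)"
  using assms unfolding mid_arrow_def by simp

text \<open>The arguments are the column of \<open>Suc t\<close>: one arrow in, from
  \<open>n\<close>, and two out, to \<open>t\<close> and \<open>t + 2\<close>. So all paths start at
  \<open>n\<close> and end at one of these two; \<open>t + 2 < n\<close> keeps the three
  apart.\<close>

lemma pass_indicator:
  assumes "t + 2 < (n::nat)"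
  shows "pass (of_bool (i = n) - of_bool (i = t) - of_bool (i = t + 2))
      (of_bool (j = n) - of_bool (j = t) - of_bool (j = t + 2)) =
    of_bool (i = n \<and> (j = t \<or> j = t + 2)) - of_bool (j = n \<and> (i = t \<or> i = t + 2))"
  using assms
  apply (auto simp: pass_def)
  done

lemma mid_quiver_step:
  assumes "Suc t < n - 1" "1 \<le> i" "i \<le> n" "1 \<le> j" "j \<le> n"
  shows "mid_quiver n (Suc t) i j =
    (if i = Suc t \<or> j = Suc t then - mid_quiver n t i j
     else mid_quiver n t i j + pass (mid_quiver n t i (Suc t)) (mid_quiver n t j (Suc t)))"
proof (cases "i = Suc t \<or> j = Suc t")
  case True
  then show ?thesis
    using mid_quiver_col[OF assms(1,2,3)] mid_quiver_col[OF assms(1,4,5)]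
      mid_quiver_col_after[OF assms(1,2,3)] mid_quiver_col_after[OF assms(1,4,5)]
      mid_quiver_anti[of n "Suc t" j "Suc t"] mid_quiver_anti[of n t j "Suc t"]
    by auto
next
  case False
  have "t + 2 < n" using assms(1) by simp
  have split:
    "of_bool (i = n \<and> (j = t \<or> j = t + 2)) = of_bool (j = t \<and> i = n) + (of_bool (i = n \<and> j = t + 2) :: int)"
    "of_bool (j = n \<and> (i = t \<or> i = t + 2)) = of_bool (i = t \<and> j = n) + (of_bool (j = n \<and> i = t + 2) :: int)"
    by auto
  have "mid_quiver n (Suc t) i j =
      mid_quiver n t i j + pass (mid_quiver n t i (Suc t)) (mid_quiver n t j (Suc t))"
    using mid_arrow_step[OF assms(1), of i j] mid_arrow_step[OF assms(1), of j i] False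
    unfolding mid_quiver_col[OF assms(1,2,3)] mid_quiver_col[OF assms(1,4,5)]
      pass_indicator[OF \<open>t + 2 < n\<close>]
    unfolding split unfolding mid_quiver_def
    by linarith
  then show ?thesis using False by simp
qed

section \<open>Partial sums and products\<close>

definition pre_prod :: "(nat \<Rightarrow> 'a::field) \<Rightarrow> nat \<Rightarrow> 'a" where
  "pre_prod Y j = (\<Prod>k=0..j. Y k)"

definition pre_sum :: "(nat \<Rightarrow> 'a::field) \<Rightarrow> nat \<Rightarrow> 'a" where
  "pre_sum Y m = (\<Sum>j<m. pre_prod Y j)"

definition suf_prod :: "nat \<Rightarrow> (nat \<Rightarrow> 'a::field) \<Rightarrow> nat \<Rightarrow> 'a" where
  "suf_prod n Y i = (\<Prod>k=i..n. Y k)"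

definition suf_sum :: "nat \<Rightarrow> (nat \<Rightarrow> 'a::field) \<Rightarrow> nat \<Rightarrow> 'a" where
  "suf_sum n Y i = (\<Sum>j=i..n. \<Prod>k=i..<j. Y k)"

text \<open>With \<open>Y 0 = 1\<close> this is the cyclic sum
  \<open>1 + Y i + Y i * Y (i + 1) + ...\<close> of the \<open>n\<close> partial products of lengths
  0 to \<open>n - 1\<close>, read around the middle circle from \<open>i\<close>.\<close>

definition tot :: "nat \<Rightarrow> (nat \<Rightarrow> 'a::field) \<Rightarrow> nat \<Rightarrow> 'a" where
  "tot n Y i = suf_sum n Y i + suf_prod n Y i * pre_sum Y (i - 1)"

lemma pre_prod_Suc: "pre_prod Y (Suc j) = pre_prod Y j * Y (Suc j)"
  by (simp add: pre_prod_def)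

lemma pre_sum_Suc: "pre_sum Y (Suc m) = pre_sum Y m + pre_prod Y m"
  by (simp add: pre_sum_def)

lemma pre_sum_0 [simp]: "pre_sum Y 0 = 0"
  by (simp add: pre_sum_def)

lemma suf_prod_rec: "i \<le> n \<Longrightarrow> suf_prod n Y i = Y i * suf_prod n Y (Suc i)"
  by (simp add: suf_prod_def prod.atLeast_Suc_atMost)

lemma suf_sum_rec: 
  assumes "i \<le> n" 
  shows "suf_sum n Y i = 1 + Y i * suf_sum n Y (Suc i)"
proof -
  have "suf_sum n Y i = 1 + (\<Sum>j=Suc i..n. \<Prod>k=i..<j. Y k)"
    using assms by (simp add: suf_sum_def sum.atLeast_Suc_atMost)
  also have "(\<Sum>j=Suc i..n. \<Prod>k=i..<j. Y k) = (\<Sum>j=Suc i..n. Y i * (\<Prod>k=Suc i..<j. Y k))"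
    by (intro sum.cong refl prod.atLeast_Suc_lessThan) auto
  finally show ?thesis
    by (simp add: suf_sum_def sum_distrib_left)
qed

lemma suf_Suc_n [simp]: "suf_prod n Y (Suc n) = 1" "suf_sum n Y (Suc n) = 0"
  by (simp_all add: suf_prod_def suf_sum_def)

lemma pre_sum_eq:
  assumes "i \<le> n" 
  shows "pre_sum Y n = pre_sum Y i + pre_prod Y i * suf_sum n Y (Suc i)"
  using assms
proof (induction rule: inc_induct)
  case (step i)
  then show ?case
    by (simp add: suf_sum_rec[of "Suc i"] pre_sum_Suc pre_prod_Suc algebra_simps)
qed simp

text \<open>Position \<open>Suc n\<close> stands for position 1, where \<open>tot_1\<close> gives
  the same value; so the closed forms below hold up to the end of the circle.\<close>

lemma tot_Suc_n: "tot n Y (Suc n) = pre_sum Y n"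
  by (simp add: tot_def)

lemma tot_1: "Y 0 = 1 \<Longrightarrow> tot n Y 1 = pre_sum Y n"
  using pre_sum_eq[of 0 n Y] by (simp add: tot_def pre_prod_def)

text \<open>Splitting \<open>pre_sum Y n\<close> at \<open>i\<close> and unfolding the suffixes once
  leaves a polynomial identity. Divided by \<open>pre_sum Y n\<close>, it evaluates
  \<open>1 + x\<close> for the variables \<open>x\<close> met in the second sweep.\<close>

lemma tot_rec:
  assumes "1 \<le> i" "i \<le> n"
  shows "pre_sum Y i * tot n Y i = pre_sum Y n + Y i * pre_sum Y (i - 1) * tot n Y (Suc i)"
proof -
  obtain m where m: "i = Suc m" using assms by (cases i) auto
  have "pre_sum Y n = pre_sum Y i + pre_prod Y i * suf_sum n Y (Suc i)"
    using assms by (intro pre_sum_eq)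
  then show ?thesis
    using assms unfolding m
    by (simp add: tot_def suf_sum_rec[of "Suc m"] suf_prod_rec[of "Suc m"] pre_sum_Suc pre_prod_Suc 
      algebra_simps)
qed

section \<open>Sums and products stay in the semifield\<close>

lemma semifield_sum:
  assumes "semifield_in P" "finite I" "I \<noteq> {}" "\<And>i. i \<in> I \<Longrightarrow> h i \<in> P"
  shows "sum h I \<in> P"
  using assms(2,3,4)
  by (induction rule: finite_ne_induct) (use assms(1) in \<open>auto simp: semifield_in_def\<close>)

lemma semifield_prod:
  assumes "semifield_in P" "\<And>i. i \<in> I \<Longrightarrow> h i \<in> P"
  shows "prod h I \<in> P"
  using assms(2)
  by (induction I rule: infinite_finite_induct) (use assms(1) in \<open>auto simp: semifield_in_def\<close>)

lemma
  assumes "semifield_in P" "\<And>k. k \<le> n \<Longrightarrow> Y k \<in> P"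
  shows pre_prod_in: "j \<le> n \<Longrightarrow> pre_prod Y j \<in> P"
    and pre_sum_in: "1 \<le> m \<Longrightarrow> m \<le> Suc n \<Longrightarrow> pre_sum Y m \<in> P"
    and tot_in: "Y 0 = 1 \<Longrightarrow> 1 \<le> i \<Longrightarrow> i \<le> Suc n \<Longrightarrow> 1 \<le> n \<Longrightarrow> tot n Y i \<in> P"
proof -
  show pp: "pre_prod Y j \<in> P" if "j \<le> n" for j
    unfolding pre_prod_def by (intro semifield_prod assms) (use that in auto)
  show ps: "pre_sum Y m \<in> P" if "1 \<le> m" "m \<le> Suc n" for m
    unfolding pre_sum_def by (intro semifield_sum assms pp) (use that in \<open>auto simp: lessThan_empty_iff\<close>)
  show "tot n Y i \<in> P" if i: "1 \<le> i" "i \<le> Suc n" "Y 0 = 1" "1 \<le> n"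
  proof -
    \<comment> \<open>In the first two cases one summand of \<open>tot\<close> is 0, which is not in
      \<open>P\<close>; there \<open>tot\<close> is a prefix sum.\<close>
    consider "i = 1" | "i = Suc n" | "2 \<le> i" "i \<le> n" using i by linarith
    then show ?thesis
    proof cases
      case 3
      have "suf_sum n Y i \<in> P" unfolding suf_sum_def
        by (intro semifield_sum semifield_prod assms) (use 3 in auto)
      moreover have "suf_prod n Y i \<in> P" unfolding suf_prod_def
        by (intro semifield_prod assms) (use 3 in auto)
      moreover have "pre_sum Y (i - 1) \<in> P" using 3 by (intro ps) auto
      ultimately show ?thesis using assms(1) by (auto simp: tot_def semifield_in_def)
    qed (use i tot_1[of Y n] in \<open>auto simp: tot_Suc_n intro!: ps\<close>)
  qed
qed

section \<open>The two sweeps of mutations\<close>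

abbreviation arr :: "('v, 'a) seed \<Rightarrow> 'v \<Rightarrow> 'v \<Rightarrow> int" where
  "arr s \<equiv> arrows (fst s)"

lemma pass_0 [simp]: "pass a 0 = 0" "pass 0 b = 0"
  by (simp_all add: pass_def)

lemma pass_minus: "pass (- a) (- b) = - pass a b"
  by (simp add: pass_def)

lemma arrows_self [simp]: "arrows Q u u = 0"
  by (simp add: arrows_def)

lemma reduced_mutate [simp]: "reduced (fst (mutate k s))"
  by (simp add: mutate_def)

lemma reduced_swap_vertices [simp]: "reduced (fst s) \<Longrightarrow> reduced (fst (swap_vertices a b s))"
  by (simp add: swap_vertices_def reduced_def)

lemma arr_mutate:
  assumes "reduced (fst s)"
  shows "arr (mutate k s) i j =
    (if i = k \<or> j = k then - arr s i j else arr s i j + pass (arr s i k) (arr s j k))"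
  using arrows_mutate_quiver[OF assms] by (simp add: mutate_def)

lemma snd_mutate:
  assumes "reduced (fst s)"
  shows "snd (mutate k s) i =
    (if i = k then inverse (snd s k) else snd s i * ymult (arr s i k) (snd s k))"
  by (simp add: mutate_def mutate_vars_ymult[OF assms])

text \<open>Mutation at a vertex of \<open>V\<close> computes arrows inside \<open>V\<close> from
  arrows inside \<open>V\<close>. Later \<open>V\<close> is the middle circle, possibly with one
  more vertex.\<close>

definition agree :: "'v set \<Rightarrow> ('v, 'a) seed \<Rightarrow> ('v, 'a) seed \<Rightarrow> bool" where
  "agree V s s' \<longleftrightarrow> (\<forall>u\<in>V. \<forall>w\<in>V. arr s u w = arr s' u w)"

lemma agree_mutate:
  assumes "reduced (fst s)" "reduced (fst s')" "agree V s s'" "k \<in> V"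
  shows "agree V (mutate k s) (mutate k s')"
  using assms by (simp add: agree_def arr_mutate)

text \<open>The first mutation negates the column of \<open>k\<close>, so the second one adds the
  opposite correction.\<close>

lemma agree_mutate_mutate:
  assumes "reduced (fst s)"
  shows "agree V (mutate k (mutate k s)) s"
  using assms arrows_anti[of "fst s" k] by (auto simp: agree_def arr_mutate pass_minus)

lemma agree_trans: "agree V s s' \<Longrightarrow> agree V s' s'' \<Longrightarrow> agree V s s''"
  by (simp add: agree_def)

text \<open>As the columns are opposite, each path \<open>u -> a -> w\<close> is matched by a path
  \<open>w -> b -> u\<close>, and the corrections cancel. What remains is a reversal of the arrows
  at \<open>a\<close> and \<open>b\<close>, which the exchange undoes.\<close>

lemma agree_double_mutate_swap:
  assumes red: "reduced (fst s)" and ab: "a \<in> V" "b \<in> V" "a \<noteq> b" "arr s a b = 0"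
    and opp: "\<And>u. u \<in> V \<Longrightarrow> u \<noteq> a \<Longrightarrow> u \<noteq> b \<Longrightarrow> arr s u b = - arr s u a"
  shows "agree V (swap_vertices a b (mutate b (mutate a s))) s"
proof -
  have ba: "arr s b a = 0"
    using arrows_anti[of "fst s" b a] ab(4) by simp
  have opp': "arr s b u = - arr s a u" if "u \<in> V" "u \<noteq> a" "u \<noteq> b" for u
    using opp[OF that] arrows_anti[of "fst s" b u] arrows_anti[of "fst s" a u] by simp
  have "arr (mutate b (mutate a s)) (Transposition.transpose a b u) (Transposition.transpose a b w)
      = arr s u w" if "u \<in> V" "w \<in> V" for u w
    using that ab ba opp opp'
    by (auto simp: arr_mutate red pass_minus Transposition.transpose_def)
  then show ?thesis
    by (simp add: agree_def swap_vertices_def arrows_def)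
qed

text \<open>Without arrows between \<open>a\<close> and \<open>b\<close>, mutation at
  \<open>a\<close> changes neither the variable at \<open>b\<close> nor the arrows to
  \<open>b\<close>.\<close>

lemma snd_double_mutate_swap:
  assumes red: "reduced (fst s)" and ab: "a \<noteq> b" "arr s a b = 0"
  shows "snd (swap_vertices a b (mutate b (mutate a s))) a = inverse (snd s b)"
    "snd (swap_vertices a b (mutate b (mutate a s))) b = inverse (snd s a)"
    "u \<noteq> a \<Longrightarrow> u \<noteq> b \<Longrightarrow> snd (swap_vertices a b (mutate b (mutate a s))) u =
      snd s u * ymult (arr s u a) (snd s a) * ymult (arr s u b) (snd s b)"
  using arrows_anti[of "fst s" b a] ab
  by (simp_all add: swap_vertices_def snd_mutate arr_mutate red)

definition up :: "(vertex, 'a::field) seed \<Rightarrow> nat \<Rightarrow> (vertex, 'a) seed" where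
  "up s t = fold (\<lambda>k. mutate (Mid k)) [1..<Suc t] s"

text \<open>\<open>down n s t\<close> is the seed in the second sweep when the vertices \<open>n - 2, \<dots>, t + 1\<close> are done; its
  quiver agrees with that of \<open>up s t\<close>.\<close>

definition down :: "nat \<Rightarrow> (vertex, 'a::field) seed \<Rightarrow> nat \<Rightarrow> (vertex, 'a) seed" where
  "down n s t = fold (\<lambda>k. mutate (Mid k)) (rev [Suc t..<n - 1])
     (swap_vertices (Mid (n - 1)) (Mid n) (up s n))"

lemma up_0 [simp]: "up s 0 = s"
  by (simp add: up_def)

lemma up_Suc: "up s (Suc t) = mutate (Mid (Suc t)) (up s t)"
  by (simp add: up_def)

lemma tau_eq_down: "tau n s = down n s 0"
  by (simp add: tau_def down_def up_def)

lemma down_top: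
  assumes "n \<ge> 2"
  shows "down n s (n - 2) = swap_vertices (Mid (n - 1)) (Mid n)
    (mutate (Mid n) (mutate (Mid (n - 1)) (up s (n - 2))))"
proof -
  obtain m where "n = Suc (Suc m)" using assms by (metis add_2_eq_Suc le_Suc_ex)
  then show ?thesis by (simp add: down_def up_Suc)
qed

lemma down_step:
  assumes "Suc t < n - 1"
  shows "down n s t = mutate (Mid (Suc t)) (down n s (Suc t))"
  using assms by (simp add: down_def upt_conv_Cons)

lemma reduced_up [simp]: "reduced (fst s) \<Longrightarrow> reduced (fst (up s t))"
  by (induction t) (simp_all add: up_Suc)

definition twins :: "nat \<Rightarrow> vertex set \<Rightarrow> (vertex, 'a) seed \<Rightarrow> bool" where
  "twins n V s \<longleftrightarrow> arr s (Mid (n - 1)) (Mid n) = 0 \<and>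
     (\<forall>u\<in>V - {Mid (n - 1), Mid n}. arr s u (Mid n) = - arr s u (Mid (n - 1)))"

text \<open>Downward induction: the twins are treated at the top, and each later mutation repeats,
  on the same arrows, the one that the first sweep made at this vertex.\<close>

lemma down_agree:
  assumes red: "reduced (fst s)" and n: "n \<ge> 2" and V: "Mid ` {1..n} \<subseteq> V"
    and tw: "twins n V (up s (n - 2))" and "t \<le> n - 2"
  shows "reduced (fst (down n s t)) \<and> agree V (down n s t) (up s t)"
  using \<open>t \<le> n - 2\<close>
proof (induction rule: inc_induct)
  case base
  have "Mid (n - 1) \<in> V" "Mid n \<in> V" "Mid (n - 1) \<noteq> Mid n" using V n by auto
  then show ?case
    unfolding down_top[OF n]
    using agree_double_mutate_swap[of "up s (n - 2)" "Mid (n - 1)" V "Mid n"] tw red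
    by (auto simp: twins_def)
next
  case (step t)
  then have t: "Suc t < n - 1" by simp
  have "agree V (mutate (Mid (Suc t)) (down n s (Suc t))) (mutate (Mid (Suc t)) (up s (Suc t)))"
    using step V red t by (intro agree_mutate) auto
  moreover have "agree V (mutate (Mid (Suc t)) (up s (Suc t))) (up s t)"
    unfolding up_Suc by (rule agree_mutate_mutate) (use red in simp)
  ultimately show ?case
    unfolding down_step[OF t] by (auto intro: agree_trans)
qed

lemma snd_up_frozen:
  assumes "reduced (fst s)" "v \<notin> Mid ` {1..t}"
  shows "snd (up s t) v = snd s v *
    (\<Prod>k=1..t. ymult (arr (up s (k - 1)) v (Mid k)) (snd (up s (k - 1)) (Mid k)))"
  using assms(2)
proof (induction t)
  case (Suc t)
  have "v \<noteq> Mid (Suc t)" "v \<notin> Mid ` {1..t}" using Suc.prems by auto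
  then show ?case using Suc.IH by (simp add: up_Suc snd_mutate assms(1))
qed simp

text \<open>The second visit to \<open>Mid k\<close> meets the arrows of \<open>up s k\<close>, the
  first met those of \<open>up s (k - 1)\<close>; mutation at \<open>Mid k\<close> lies in between,
  hence the minus sign.\<close>

lemma snd_down_frozen:
  assumes red: "reduced (fst s)" and n: "n \<ge> 2" and V: "Mid ` {1..n} \<subseteq> V" "v \<in> V"
    and v: "v \<notin> Mid ` {1..n}"
    and tw: "twins n V (up s (n - 2))" and "t \<le> n - 2"
  shows "snd (down n s t) v = snd (down n s (n - 2)) v *
    (\<Prod>k=Suc t..n - 2. ymult (- arr (up s (k - 1)) v (Mid k)) (snd (down n s k) (Mid k)))"
  using \<open>t \<le> n - 2\<close>
proof (induction rule: inc_induct)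
  case (step t)
  then have t: "Suc t < n - 1" by simp
  have r: "reduced (fst (down n s (Suc t)))" and a: "agree V (down n s (Suc t)) (up s (Suc t))"
    using down_agree[OF red n V(1) tw] step by auto
  have m: "Mid (Suc t) \<in> V" "v \<noteq> Mid (Suc t)" using V(1) t v by auto
  have "arr (down n s (Suc t)) v (Mid (Suc t)) = - arr (up s t) v (Mid (Suc t))"
    using a V(2) m red by (simp add: agree_def up_Suc arr_mutate)
  then have "snd (down n s t) v = snd (down n s (Suc t)) v *
      ymult (- arr (up s t) v (Mid (Suc t))) (snd (down n s (Suc t)) (Mid (Suc t)))"
    unfolding down_step[OF t] using m(2) r by (simp add: snd_mutate)
  moreover have "(\<Prod>k=Suc t..n - 2. ymult (- arr (up s (k - 1)) v (Mid k)) (snd (down n s k) (Mid k)))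
     = ymult (- arr (up s t) v (Mid (Suc t))) (snd (down n s (Suc t)) (Mid (Suc t))) *
       (\<Prod>k=Suc (Suc t)..n - 2. ymult (- arr (up s (k - 1)) v (Mid k)) (snd (down n s k) (Mid k)))"
    using step.hyps by (subst prod.atLeast_Suc_atMost) auto
  ultimately show ?case
    using step.IH by (simp add: mult_ac)
qed simp

section \<open>The variables of the middle circle\<close>

lemma twins_col:
  assumes "n \<ge> 2" "1 \<le> i" "i \<le> n"
  shows "mid_quiver n (n - 2) i (n - 1) = - of_bool (i = n - 2)"
    "mid_quiver n (n - 2) i n = of_bool (i = n - 2)"
proof -
  obtain m where "n = Suc (Suc m)" using assms by (metis add_2_eq_Suc le_Suc_ex)
  then show "mid_quiver n (n - 2) i (n - 1) = - of_bool (i = n - 2)"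
    "mid_quiver n (n - 2) i n = of_bool (i = n - 2)"
    using assms by (auto simp: mid_quiver_def mid_arrow_def of_bool_def)
qed

lemma up_mid_quiver:
  assumes red: "reduced (fst s)"
    and mid: "\<And>i j. i \<in> {1..n} \<Longrightarrow> j \<in> {1..n} \<Longrightarrow> arr s (Mid i) (Mid j) = mid_quiver n 0 i j"
    and "t \<le> n - 2" "i \<in> {1..n}" "j \<in> {1..n}"
  shows "arr (up s t) (Mid i) (Mid j) = mid_quiver n t i j"
  using assms(3-5)
proof (induction t arbitrary: i j)
  case (Suc t)
  then show ?case
    using red mid_quiver_step[of t n i j] by (simp add: up_Suc arr_mutate)
qed (use mid in simp)

text \<open>The branches are the vertex \<open>n\<close>, which every step changes; the vertices
  settled for the first sweep; the vertex just mutated; the next one; those not yet reached.\<close>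

definition up_var :: "nat \<Rightarrow> (nat \<Rightarrow> 'a::field) \<Rightarrow> nat \<Rightarrow> nat \<Rightarrow> 'a" where
  "up_var n Y t i =
    (if i = n then Y n * pre_sum Y (Suc t)
     else if i < t then Y (Suc i) * pre_sum Y i / pre_sum Y (i + 2)
     else if i = t then pre_sum Y t / pre_prod Y t
     else if i = Suc t then pre_prod Y (Suc t) / pre_sum Y (Suc t)
     else Y i)"

text \<open>Below \<open>t\<close> the values of the first sweep persist; strictly between
  \<open>Suc t\<close> and \<open>n\<close> the values are final.\<close>

definition down_var :: "nat \<Rightarrow> (nat \<Rightarrow> 'a::field) \<Rightarrow> nat \<Rightarrow> nat \<Rightarrow> 'a" where
  "down_var n Y t i =
    (if i = n then pre_sum Y (Suc t) * tot n Y n / (pre_prod Y (Suc t) * tot n Y (t + 2))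
     else if i < t then Y (Suc i) * pre_sum Y i / pre_sum Y (i + 2)
     else if i = t then Y (Suc t) * pre_sum Y t * tot n Y (t + 2) / pre_sum Y n
     else if i = Suc t then pre_sum Y n / (Y (t + 2) * pre_sum Y (Suc t) * tot n Y (t + 3))
     else tot n Y i / (Y (Suc i) * tot n Y (i + 2)))"

text \<open>The total factor contributed by vertex \<open>k\<close> in both sweeps. For \<open>k = n - 1\<close> the second half comes
  from mutation at \<open>n\<close>, whose variable then has the same form.\<close>

definition gain :: "nat \<Rightarrow> (nat \<Rightarrow> 'a::field) \<Rightarrow> int \<Rightarrow> nat \<Rightarrow> 'a" where
  "gain n Y c k = ymult c (pre_prod Y k / pre_sum Y k) *
     ymult (- c) (Y (Suc k) * pre_sum Y k * tot n Y (k + 2) / pre_sum Y n)"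

lemma gain_0 [simp]: "gain n Y 0 k = 1"
  by (simp add: gain_def)

locale mid_cycle_seed =
  fixes n :: nat and P :: "'a::field set" and s :: "(vertex, 'a) seed" and Y :: "nat \<Rightarrow> 'a"
  assumes n: "n \<ge> 2" and P: "semifield_in P" and red: "reduced (fst s)"
    and mid: "\<And>i j. i \<in> {1..n} \<Longrightarrow> j \<in> {1..n} \<Longrightarrow> arr s (Mid i) (Mid j) = mid_quiver n 0 i j"
    and Y0: "Y 0 = 1" and Ys: "\<And>i. i \<in> {1..n} \<Longrightarrow> snd s (Mid i) = Y i"
    and YP: "\<And>k. k \<le> n \<Longrightarrow> Y k \<in> P"
begin

lemma nonzero:
  "k \<le> n \<Longrightarrow> Y k \<noteq> 0"
  "k \<le> n \<Longrightarrow> pre_prod Y k \<noteq> 0"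
  "1 \<le> k \<Longrightarrow> k \<le> Suc n \<Longrightarrow> pre_sum Y k \<noteq> 0"
  "1 \<le> k \<Longrightarrow> k \<le> Suc n \<Longrightarrow> tot n Y k \<noteq> 0"
  using YP[of k] pre_prod_in[OF P, where Y=Y and n=n and j=k, OF YP] pre_sum_in[OF P, where Y=Y and n=n and m=k, OF YP]
    tot_in[OF P, where Y=Y and n=n and i=k, OF YP] Y0 n P
  by (auto simp: semifield_in_def)

lemma up_mid_var:
  assumes "t \<le> n - 2" "i \<in> {1..n}"
  shows "snd (up s t) (Mid i) = up_var n Y t i"
  using assms
proof (induction t arbitrary: i)
  case 0
  then show ?case using n Ys Y0 by (auto simp: up_var_def pre_sum_def pre_prod_def)
next
  case (Suc t)
  then have t: "Suc t < n - 1" "Suc t \<in> {1..n}" "Suc t \<noteq> n" "n \<noteq> Suc (Suc t)" by auto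
  define x where "x = pre_prod Y (Suc t) / pre_sum Y (Suc t)"
  have S: "pre_sum Y (Suc t) \<noteq> 0" "pre_sum Y (t + 2) \<noteq> 0" "pre_prod Y (Suc t) \<noteq> 0"
    using nonzero t by auto
  have x: "snd (up s t) (Mid (Suc t)) = x"
    using Suc.IH[of "Suc t"] Suc.prems t by (simp add: up_var_def x_def)
  have x1: "1 + x = pre_sum Y (t + 2) / pre_sum Y (Suc t)"
    using S by (simp add: x_def pre_sum_Suc field_simps)
  have x2: "ymult (- 1) x = pre_prod Y (Suc t) / pre_sum Y (t + 2)"
    using S by (subst ymult_minus_1) (simp_all add: x1, simp_all add: x_def)
  \<comment> \<open>Only the neighbours of \<open>Suc t\<close> change: \<open>n\<close> gains
    \<open>1 + x\<close>, while \<open>t\<close> and \<open>t + 2\<close> gain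
    \<open>x / (1 + x)\<close>.\<close>
  have *: "snd (up s (Suc t)) (Mid i) = (if i = Suc t then inverse x
      else up_var n Y t i * ymult (of_bool (i = n) - of_bool (i = t) - of_bool (i = t + 2)) x)"
    using Suc.IH[of i] Suc.prems up_mid_quiver[OF red mid, of t i "Suc t"] t
      mid_quiver_col[of t n i]
    by (simp add: up_Suc snd_mutate red x)
  consider "i = n" | "i < t" | "i = t" | "i = Suc t" | "i = t + 2" "i < n" | "t + 2 < i" "i < n"
    using Suc.prems by fastforce
  then show ?case
  proof cases
    case 3
    then have "pre_prod Y t \<noteq> 0" using nonzero(2)[of t] t by simp
    with 3 show ?thesis
      unfolding * using t x2 S by (simp add: up_var_def pre_prod_Suc)
  qed (unfold *, insert t x2 x1 S, simp_all add: up_var_def ymult_1 x_def pre_prod_Suc)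
qed

lemma twins_mid:
  assumes "\<And>v. v \<in> V \<Longrightarrow> v \<notin> Mid ` {1..n} \<Longrightarrow>
    arr (up s (n - 2)) v (Mid n) = - arr (up s (n - 2)) v (Mid (n - 1))"
  shows "twins n V (up s (n - 2))"
proof -
  have Q: "arr (up s (n - 2)) (Mid i) (Mid n) = of_bool (i = n - 2)"
    "arr (up s (n - 2)) (Mid i) (Mid (n - 1)) = - of_bool (i = n - 2)" if "i \<in> {1..n}" for i
    using up_mid_quiver[OF red mid, of "n - 2" i] twins_col[OF n, of i] that n by auto
  show ?thesis
    unfolding twins_def
  proof (intro conjI ballI)
    show "arr (up s (n - 2)) (Mid (n - 1)) (Mid n) = 0"
      using Q(1)[of "n - 1"] n by simp
    show "arr (up s (n - 2)) u (Mid n) = - arr (up s (n - 2)) u (Mid (n - 1))"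
      if "u \<in> V - {Mid (n - 1), Mid n}" for u
    proof (cases "u \<in> Mid ` {1..n}")
      case True
      then show ?thesis using Q by auto
    next
      case False
      then show ?thesis using assms that by blast
    qed
  qed
qed

lemma down_mid_var:
  assumes "t \<le> n - 2" "i \<in> {1..n}"
  shows "snd (down n s t) (Mid i) = down_var n Y t i"
  using assms
proof (induction arbitrary: i rule: inc_induct)
  case base
  obtain m where m: "n = Suc (Suc m)" using n by (metis add_2_eq_Suc le_Suc_ex)
  define x where "x = pre_prod Y (n - 1) / pre_sum Y (n - 1)"
  have S: "pre_sum Y (n - 1) \<noteq> 0" "pre_sum Y n \<noteq> 0" "pre_prod Y (n - 1) \<noteq> 0" "Y n \<noteq> 0" "tot n Y n \<noteq> 0"
    using nonzero n by auto
  have up: "snd (up s (n - 2)) (Mid i) = up_var n Y (n - 2) i" if "i \<in> {1..n}" for i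
    using up_mid_var[of "n - 2"] that by simp
  have upn: "snd (up s (n - 2)) (Mid n) = Y n * pre_sum Y (n - 1)" 
      "snd (up s (n - 2)) (Mid (n - 1)) = x"
    using up[of n] up[of "n - 1"] n by (simp_all add: up_var_def m x_def)
  have x1: "1 + x = pre_sum Y n / pre_sum Y (n - 1)"
    using S by (simp add: x_def m pre_sum_Suc field_simps)
  have x2: "ymult (- 1) x = pre_prod Y (n - 1) / pre_sum Y n"
    using S by (subst ymult_minus_1) (simp_all add: x1, simp_all add: x_def)
  \<comment> \<open>This is one plus the variable at \<open>n\<close>, the factor that vertex
    \<open>n - 2\<close> receives from the mutation at \<open>n\<close>.\<close>
  have T: "tot n Y n = 1 + Y n * pre_sum Y (n - 1)"
    by (simp add: tot_def suf_sum_def suf_prod_def)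
  then have T': "1 + Y (Suc (Suc m)) * pre_sum Y (Suc m) = tot (Suc (Suc m)) Y (Suc (Suc m))"
    by (simp add: m)
  have Q: "arr (up s (n - 2)) (Mid i) (Mid n) = of_bool (i = n - 2)"
    "arr (up s (n - 2)) (Mid i) (Mid (n - 1)) = - of_bool (i = n - 2)" if "i \<in> {1..n}" for i
    using up_mid_quiver[OF red mid, of "n - 2" i] twins_col[OF n, of i] that n by auto
  have a: "arr (up s (n - 2)) (Mid (n - 1)) (Mid n) = 0" and ne: "Mid (n - 1) \<noteq> Mid n"
    using Q[of "n - 1"] n by auto
  note sw = snd_double_mutate_swap[OF _ ne a, folded down_top[OF n]]
  consider "i = n" | "i = n - 1" | "i = n - 2" "i \<noteq> n" "i \<noteq> n - 1" | "i < n - 2"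
    using base by fastforce
  then show ?case
  proof cases
    case 1
    then show ?thesis
      using S sw(2) red upn by (simp add: down_var_def m x_def)
  next
    case 2
    then show ?thesis
      using S sw(1) red upn n by (simp add: down_var_def m tot_Suc_n inverse_eq_divide numeral_3_eq_3)
  next
    case 3
    then have "pre_prod Y (n - 2) \<noteq> 0" using nonzero by simp
    then show ?thesis
      using 3 S sw(3)[of "Mid i"] red upn Q[of i] up[of i] base x2
      by (simp add: down_var_def up_var_def ymult_1 T' m pre_prod_Suc)
  next
    case 4
    then have "i < n - 2" "i \<noteq> n" "i \<noteq> n - 1" by auto
    then show ?thesis
      using S sw(3)[of "Mid i"] red Q[of i] up[of i] base
      by (simp add: down_var_def up_var_def)
  qed
next
  case (step t)
  then have t: "Suc t < n - 1" "Suc t \<in> {1..n}" "Suc t \<noteq> n" "n \<noteq> Suc (Suc t)" by auto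
  define x where "x = Y (t + 2) * pre_sum Y (Suc t) * tot n Y (t + 3) / pre_sum Y n"
  have S: "pre_sum Y (Suc t) \<noteq> 0" "pre_sum Y (t + 2) \<noteq> 0" "pre_prod Y (Suc t) \<noteq> 0" "Y (t + 2) \<noteq> 0"
     "tot n Y (t + 2) \<noteq> 0" "tot n Y (t + 3) \<noteq> 0" "pre_sum Y n \<noteq> 0" "pre_prod Y (t + 2) \<noteq> 0"
    using nonzero t by auto
  have x: "snd (down n s (Suc t)) (Mid (Suc t)) = x"
    using step.IH[of "Suc t"] step.prems t by (simp add: down_var_def x_def numeral_3_eq_3)
  \<comment> \<open>The recursion \<open>tot_rec\<close> at \<open>t + 2\<close> turns
    \<open>1 + x\<close> into a single quotient, so all further factors cancel.\<close>
  have x1: "1 + x = pre_sum Y (t + 2) * tot n Y (t + 2) / pre_sum Y n"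
    using S tot_rec[of "t + 2" n Y] t by (simp add: x_def field_simps numeral_3_eq_3)
  have x2: "ymult (- 1) x = Y (t + 2) * pre_sum Y (Suc t) * tot n Y (t + 3) / (pre_sum Y (t + 2) * tot n Y (t + 2))"
    using S by (subst ymult_minus_1) (simp_all add: x1, simp_all add: x_def)
  have tw: "twins n (Mid ` {1..n}) (up s (n - 2))"
    by (rule twins_mid) simp
  have r: "reduced (fst (down n s (Suc t)))" 
    and a: "agree (Mid ` {1..n}) (down n s (Suc t)) (up s (Suc t))"
    using down_agree[OF red n _ tw] step by auto
  \<comment> \<open>By agreement with \<open>up s (Suc t)\<close> the column of \<open>Suc t\<close>
    is reversed: \<open>t\<close> and \<open>t + 2\<close> gain \<open>1 + x\<close>, and
    \<open>n\<close> gains \<open>x / (1 + x)\<close>.\<close>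
  have *: "snd (down n s t) (Mid i) = (if i = Suc t then inverse x
      else down_var n Y (Suc t) i * ymult (of_bool (i = t) + of_bool (i = t + 2) - of_bool (i = n)) x)"
    using step.IH[of i] step.prems up_mid_quiver[OF red mid, of "Suc t" i "Suc t"] t
      mid_quiver_col_after[of t n i] a
    by (simp add: down_step[OF t(1)] snd_mutate r x agree_def)
  consider "i = n" | "i < t" | "i = t" | "i = Suc t" | "i = t + 2" "i < n" | "t + 2 < i" "i < n"
    using step.prems by fastforce
  then show ?case
  proof cases
    case 1
    then show ?thesis
      unfolding * using t x2 S by (simp add: down_var_def pre_prod_Suc numeral_3_eq_3) (simp only: mult_ac)
  qed (unfold *, insert t x1 S, simp_all add: down_var_def ymult_1 x_def numeral_3_eq_3)
qed

lemma gain_factors: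
  assumes "1 \<le> k" "k < n"
  shows "1 + pre_prod Y k / pre_sum Y k = pre_sum Y (Suc k) / pre_sum Y k"
    "1 + Y (Suc k) * pre_sum Y k * tot n Y (k + 2) / pre_sum Y n =
      pre_sum Y (Suc k) * tot n Y (Suc k) / pre_sum Y n"
  using nonzero(3)[of k] nonzero(3)[of n] tot_rec[of "Suc k" n Y] assms
  by (simp_all add: pre_sum_Suc field_simps)

text \<open>The prefix sums of the two sweeps cancel, which leaves a quotient that telescopes in
  \<open>k\<close>.\<close>

lemma gain_1:
  assumes "1 \<le> k" "k < n"
  shows "gain n Y 1 k = Y (Suc k) * tot n Y (k + 2) / tot n Y (Suc k)"
  using nonzero(1)[of "Suc k"] nonzero(3)[of k] nonzero(3)[of "Suc k"] nonzero(3)[of n]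
    nonzero(4)[of "k + 2"] nonzero(4)[of "Suc k"] gain_factors[OF assms] assms
  by (simp add: gain_def ymult_1 ymult_minus_1)

lemma gain_minus_1:
  assumes "1 \<le> k" "k < n"
  shows "gain n Y (- 1) k = pre_prod Y k * tot n Y (Suc k) / pre_sum Y n"
  using nonzero(2)[of k] nonzero(3)[of k] nonzero(3)[of "Suc k"] nonzero(3)[of n]
    nonzero(4)[of "Suc k"] gain_factors[OF assms] assms
  by (simp add: gain_def ymult_1 ymult_minus_1)

lemma tau_frozen_var:
  assumes v: "v \<notin> Mid ` {1..n}"
    and tw: "arr (up s (n - 2)) v (Mid n) = - arr (up s (n - 2)) v (Mid (n - 1))"
  shows "snd (tau n s) v = snd s v * (\<Prod>k=1..n - 1. gain n Y (arr (up s (k - 1)) v (Mid k)) k)"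
proof -
  obtain m where m: "n = Suc (Suc m)" using n by (metis add_2_eq_Suc le_Suc_ex)
  define u where "u = (\<lambda>k. arr (up s (k - 1)) v (Mid k))"
  define a where "a = (\<lambda>k. pre_prod Y k / pre_sum Y k)"
  define b where "b = (\<lambda>k. Y (Suc k) * pre_sum Y k * tot n Y (k + 2) / pre_sum Y n)"
  \<comment> \<open>Including \<open>v\<close> in the vertex set makes its arrows, too, return to
    their earlier values in the second sweep.\<close>
  have tws: "twins n (insert v (Mid ` {1..n})) (up s (n - 2))"
    by (rule twins_mid) (use tw in auto)
  have up: "snd (up s (n - 2)) (Mid i) = up_var n Y (n - 2) i" if "i \<in> {1..n}" for i
    using up_mid_var[of "n - 2"] that by simp
  have "snd (up s (k - 1)) (Mid k) = a k" if "k \<in> {1..m}" for k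
    using up_mid_var[of "k - 1" k] that by (auto simp: up_var_def a_def m)
  moreover have "v \<notin> Mid ` {1..m}" using v by (auto simp: m)
  \<comment> \<open>Three stages follow: the first sweep up to \<open>m = n - 2\<close>, the twins
    with their exchange, and the second sweep.\<close>
  ultimately have 1: "snd (up s m) v = snd s v * (\<Prod>k=1..m. ymult (u k) (a k))"
    using snd_up_frozen[OF red, of v m] by (simp add: u_def)
  have "snd (up s m) (Mid n) = b (Suc m)"
    using up[of n] nonzero(3)[of n] by (simp add: m up_var_def b_def tot_Suc_n)
  moreover have "snd (up s m) (Mid (Suc m)) = a (Suc m)"
    using up[of "Suc m"] by (simp add: m up_var_def a_def)
  moreover have "arr (up s m) (Mid (Suc m)) (Mid n) = 0"
    using tws by (simp add: twins_def m)
  moreover have "v \<noteq> Mid (Suc m)" "v \<noteq> Mid n" using v by (auto simp: m)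
  ultimately have 2: "snd (down n s m) v =
      snd (up s m) v * ymult (u (Suc m)) (a (Suc m)) * ymult (- u (Suc m)) (b (Suc m))"
    using down_top[OF n, of s] tw red
      snd_double_mutate_swap(3)[of "up s m" "Mid (Suc m)" "Mid n" v]
    by (auto simp: m u_def)
  have "snd (down n s k) (Mid k) = b k" if "k \<in> {1..m}" for k
    using down_mid_var[of k k] that by (auto simp: down_var_def b_def m)
  then have 3: "snd (down n s 0) v = snd (down n s m) v * (\<Prod>k=1..m. ymult (- u k) (b k))"
    using snd_down_frozen[OF red n _ _ v tws, of 0] by (simp add: u_def m subset_insertI)
  have "snd (tau n s) v = snd s v * ((\<Prod>k=1..m. gain n Y (u k) k) * gain n Y (u (Suc m)) (Suc m))"
    unfolding tau_eq_down 3 2 1 by (simp add: gain_def prod.distrib a_def b_def mult_ac)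
  then show ?thesis by (simp add: m u_def)
qed

end

section \<open>Rows of vertices off the middle circle\<close>

text \<open>The arrows to the middle circle, after \<open>t\<close> mutations, of a vertex with one arrow to \<open>p\<close> and one
  from \<open>q\<close>, where \<open>p \<le> q\<close>: the sum over \<open>p \<le> k < q\<close> of the evolution of \<open>e\<^sub>k - e\<^sub>k\<^sub>+\<^sub>1\<close>, which becomes
  \<open>e\<^sub>k\<^sub>-\<^sub>1 - e\<^sub>k\<close> at time \<open>k\<close>.\<close>

definition arc_row :: "nat \<Rightarrow> nat \<Rightarrow> nat \<Rightarrow> nat \<Rightarrow> int" where
  "arc_row p q t j = (let r = max (p - 1) (min t (q - 1)) in
     of_bool (j = p - 1) - of_bool (j = r) + of_bool (j = Suc r) - of_bool (j = q))"

lemma arc_row_inside: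
  assumes "p \<le> Suc t" "t < q"
  shows "arc_row p q t j =
    of_bool (j = p - 1) - of_bool (j = t) + of_bool (j = Suc t) - of_bool (j = q)"
proof -
  have "max (p - 1) (min t (q - 1)) = t" using assms by linarith
  then show ?thesis by (simp add: arc_row_def)
qed

lemma arc_row_before:
  assumes "1 \<le> p" "p \<le> q" "t < p"
  shows "arc_row p q t j = of_bool (j = p) - of_bool (j = q)"
proof -
  have "max (p - 1) (min t (q - 1)) = p - 1" "Suc (p - 1) = p" using assms by linarith+
  then show ?thesis by (simp only: arc_row_def Let_def)
qed

lemma arc_row_after:
  assumes "1 \<le> p" "p \<le> q" "q \<le> Suc t"
  shows "arc_row p q t j = of_bool (j = p - 1) - of_bool (j = q - 1)"
proof -
  have "max (p - 1) (min t (q - 1)) = q - 1" "Suc (q - 1) = q" using assms by linarith+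
  then show ?thesis by (simp only: arc_row_def Let_def)
qed

text \<open>This is the entry that mutation at \<open>Suc t\<close> meets. It is 0 or 1, so
  \<open>pass\<close> takes a simple form and the evolution can be given explicitly.\<close>

lemma arc_row_diag:
  assumes "1 \<le> p" "p \<le> q"
  shows "arc_row p q t (Suc t) = of_bool (p \<le> Suc t \<and> Suc t < q)"
proof -
  consider "Suc t < p" | "p \<le> Suc t" "Suc t < q" | "q \<le> Suc t" by linarith
  then show ?thesis
  proof cases
    case 1
    with assms show ?thesis by (simp add: arc_row_before)
  next
    case 2
    moreover from this assms have "Suc t \<noteq> p - 1" by linarith
    ultimately show ?thesis using assms by (auto simp: arc_row_inside)
  next
    case 3
    moreover from this assms have "Suc t \<noteq> p - 1" "Suc t \<noteq> q - 1" by linarith+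
    ultimately show ?thesis using assms by (auto simp: arc_row_after)
  qed
qed

lemma arc_row_step:
  assumes "1 \<le> p" "p \<le> q"
  shows "arc_row p q (Suc t) j = (if j = Suc t then - arc_row p q t j else arc_row p q t j +
    of_bool (p \<le> Suc t \<and> Suc t < q) * (of_bool (j = t) + of_bool (j = t + 2)))"
proof -
  consider "Suc t < p" | "p \<le> Suc t" "Suc t < q" | "q \<le> Suc t" by linarith
  then show ?thesis
  proof cases
    case 1
    with assms show ?thesis by (simp add: arc_row_before)
  next
    case 2
    moreover from this assms have "Suc t \<noteq> p - 1" by linarith
    ultimately show ?thesis using assms by (auto simp: arc_row_inside)
  next
    case 3
    moreover from this assms have "Suc t \<noteq> p - 1" "Suc t \<noteq> q - 1" by linarith+
    ultimately show ?thesis using assms by (auto simp: arc_row_after)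
  qed
qed

text \<open>This provides the twin condition. If \<open>q < n\<close>, the row has moved to
  positions at most \<open>n - 2\<close>; if \<open>p < q = n\<close>, the entries at
  \<open>n - 1\<close> and \<open>n\<close> are 1 and -1; otherwise the row is 0.\<close>

lemma arc_row_top:
  assumes "1 \<le> p" "p \<le> q" "q \<le> n" "n \<ge> 2"
  shows "arc_row p q (n - 2) n = - arc_row p q (n - 2) (n - 1)"
proof -
  obtain m where m: "n = Suc (Suc m)" using assms by (metis add_2_eq_Suc le_Suc_ex)
  consider "q \<le> Suc m" | "q = n" "p < n" | "p = n" "q = n" using assms m by linarith
  then show ?thesis
  proof cases
    case 1
    then have "n \<noteq> p - 1" "n \<noteq> q - 1" "Suc m \<noteq> p - 1" "Suc m \<noteq> q - 1" using assms m by linarith+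
    then show ?thesis using 1 assms by (simp add: arc_row_after m)
  next
    case 2
    then have "n \<noteq> p - 1" "Suc m \<noteq> p - 1" using assms m by linarith+
    then show ?thesis using 2 assms by (simp add: arc_row_inside m)
  next
    case 3
    then show ?thesis using assms by (simp add: arc_row_before m)
  qed
qed

lemma pass_1: "pass 1 b = max 0 (- b)" "pass (- 1) b = - max 0 b"
  by (simp_all add: pass_def)

section \<open>Evolution of the rows in the first sweep\<close>

context mid_cycle_seed
begin

lemma row_step:
  assumes v: "v \<notin> Mid ` {1..n}" and "Suc t \<le> n - 2" "j \<in> {1..n}"
  shows "arr (up s (Suc t)) v (Mid j) =
    (if j = Suc t then - arr (up s t) v (Mid j)
     else arr (up s t) v (Mid j) + pass (arr (up s t) v (Mid (Suc t)))
       (of_bool (j = n) - of_bool (j = t) - of_bool (j = t + 2)))"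
proof -
  have "v \<noteq> Mid (Suc t)" using v assms by auto
  then show ?thesis
    using up_mid_quiver[OF red mid, of t j "Suc t"] mid_quiver_col[of t n j] assms(2,3) red
    by (simp add: up_Suc arr_mutate)
qed

lemma row_arc:
  assumes v: "v \<notin> Mid ` {1..n}" and pq: "1 \<le> p" "p \<le> q" "q \<le> n"
    and row: "\<And>j. j \<in> {1..n} \<Longrightarrow> arr s v (Mid j) = of_bool (j = p) - of_bool (j = q)"
    and "t \<le> n - 2" "j \<in> {1..n}"
  shows "arr (up s t) v (Mid j) = arc_row p q t j"
  using assms(6,7)
proof (induction t arbitrary: j)
  case 0
  then show ?case using row pq by (simp add: arc_row_before)
next
  case (Suc t)
  have IH: "arr (up s t) v (Mid j) = arc_row p q t j" if "j \<in> {1..n}" for j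
    using Suc that by auto
  have "arr (up s t) v (Mid (Suc t)) = of_bool (p \<le> Suc t \<and> Suc t < q)"
    using IH[of "Suc t"] Suc.prems arc_row_diag[OF pq(1,2), of t] by simp
  then show ?case
    using row_step[OF v Suc.prems] IH[OF Suc.prems(2)] arc_row_step[OF pq(1,2), of t j] Suc.prems
    by (cases "p \<le> Suc t \<and> Suc t < q") (auto simp: pass_1)
qed

text \<open>The row is an arc from \<open>q\<close> to \<open>n\<close> plus an arrow to
  \<open>n\<close> and one from \<open>p\<close>. Although \<open>pass\<close> is not additive, the
  parts evolve independently: the arc is met only from \<open>q\<close> on, the rest only at
  \<open>p < q\<close>. At \<open>p\<close>, the path \<open>n -> p -> v\<close> cancels the arrow
  to \<open>n\<close>, and the arrow from \<open>p\<close> is reversed.\<close>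

lemma row_wrap:
  assumes v: "v \<notin> Mid ` {1..n}" and pq: "1 \<le> p" "p < q" "q \<le> n"
    and row: "\<And>j. j \<in> {1..n} \<Longrightarrow> arr s v (Mid j) = of_bool (j = q) - of_bool (j = p)"
    and "t \<le> n - 2" "j \<in> {1..n}"
  shows "arr (up s t) v (Mid j) =
    arc_row q n t j + of_bool (j = n \<and> t < p) - of_bool (j = p \<and> t < p) + of_bool (j = p \<and> p \<le> t)"
  using assms(6,7)
proof (induction t arbitrary: j)
  case 0
  then show ?case using row pq by (simp add: arc_row_before)
next
  case (Suc t)
  have q: "1 \<le> q" using pq by simp
  have IH: "arr (up s t) v (Mid j) =
      arc_row q n t j + of_bool (j = n \<and> t < p) - of_bool (j = p \<and> t < p) + of_bool (j = p \<and> p \<le> t)"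
    if "j \<in> {1..n}" for j
    using Suc that by auto
  have k: "arr (up s t) v (Mid (Suc t)) = of_bool (q \<le> Suc t \<and> Suc t < n) - of_bool (Suc t = p)"
    using IH[of "Suc t"] Suc.prems arc_row_diag[OF q pq(3), of t] by auto
  consider "Suc t < p" | "Suc t = p" | "p < Suc t" "Suc t < q" | "q \<le> Suc t" by linarith
  then show ?case
  proof cases
    case 1
    then show ?thesis
      using k row_step[OF v Suc.prems] IH[OF Suc.prems(2)] arc_row_step[OF q pq(3), of t j]
        arc_row_diag[OF q pq(3), of t] Suc.prems pq
      by simp
  next
    case 2
    then show ?thesis
      using k row_step[OF v Suc.prems] IH[OF Suc.prems(2)] arc_row_step[OF q pq(3), of t j] 
        arc_row_diag[OF q pq(3), of t] Suc.prems pq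
      by (cases "j = n") (auto simp: pass_1)
  next
    case 3
    then show ?thesis
      using k row_step[OF v Suc.prems] IH[OF Suc.prems(2)] arc_row_step[OF q pq(3), of t j]
        arc_row_diag[OF q pq(3), of t] Suc.prems pq
      by simp
  next
    case 4
    then show ?thesis
      using k row_step[OF v Suc.prems] IH[OF Suc.prems(2)] arc_row_step[OF q pq(3), of t j] Suc.prems pq
      by (cases "j = n") (auto simp: pass_1)
  qed
qed

end

section \<open>The sums of the theorem as cyclic sums\<close>

lemma sum_prod_suffix:
  assumes "a \<le> Suc e" "e \<le> n" "1 \<le> n"
  shows "(\<Sum>j=e..n - 1. \<Prod>k=a..j. Y k) = (\<Prod>k=a..e. Y k) * suf_sum n Y (Suc e)"
  using assms(2,1)
proof (induction rule: inc_induct)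
  \<comment> \<open>At \<open>e = n\<close> both sides vanish; \<open>1 \<le> n\<close> keeps
    \<open>n - 1\<close> below \<open>n\<close>.\<close>
  case base
  then show ?case using assms(3) by simp
next
  case (step e)
  then have "(\<Sum>j=e..n - 1. \<Prod>k=a..j. Y k) =
      (\<Prod>k=a..e. Y k) + (\<Sum>j=Suc e..n - 1. \<Prod>k=a..j. Y k)"
    by (intro sum.atLeast_Suc_atMost) simp
  also have "\<dots> = (\<Prod>k=a..e. Y k) + (\<Prod>k=a..e. Y k) * Y (Suc e) * suf_sum n Y (Suc (Suc e))"
    using step by simp
  finally show ?case
    using step by (simp add: suf_sum_rec[of "Suc e"] distrib_left mult.assoc)
qed

lemma pre_sum_atLeastAtMost: "1 \<le> e \<Longrightarrow> (\<Sum>j=0..e - 1. \<Prod>k=0..j. Y k) = pre_sum Y e"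
  unfolding pre_sum_def pre_prod_def by (intro sum.cong) auto

lemma prod_atLeastAtMost_split:
  fixes Y :: "nat \<Rightarrow> 'a::field"
  assumes "a \<le> Suc e" "e \<le> n"
  shows "(\<Prod>k=a..n. Y k) = (\<Prod>k=a..e. Y k) * suf_prod n Y (Suc e)"
  using prod.ub_add_nat[of a e Y "n - e"] assms by (simp add: suf_prod_def)

text \<open>All terms share the product from \<open>a\<close> to \<open>e\<close>; without it they
  run around the circle from \<open>Suc e\<close>. The formulas need \<open>a = d + 1\<close>,
  \<open>a = 0\<close> and \<open>a = e\<close>.\<close>

lemma tot_numerator:
  assumes "a \<le> Suc e" "1 \<le> e" "e \<le> n"
  shows "(\<Sum>j=e..n - 1. \<Prod>k=a..j. Y k) + (\<Prod>k=a..n. Y k) * (\<Sum>j=0..e - 1. \<Prod>k=0..j. Y k) =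
    (\<Prod>k=a..e. Y k) * tot n Y (Suc e)"
proof -
  have "1 \<le> n" using assms by simp
  then show ?thesis
    unfolding sum_prod_suffix[OF assms(1,3) \<open>1 \<le> n\<close>] pre_sum_atLeastAtMost[OF assms(2)]
      prod_atLeastAtMost_split[OF assms(1,3)]
    by (simp add: tot_def algebra_simps)
qed

lemma tot_denominator:
  assumes "1 \<le> d"
  shows "(\<Sum>j=d + 1..n. \<Prod>k=d + 1..<j. Y k) + (\<Prod>k=d + 1..n. Y k) * (\<Sum>j=0..d - 1. \<Prod>k=0..j. Y k)
    = tot n Y (Suc d)"
  unfolding pre_sum_atLeastAtMost[OF assms] by (simp add: tot_def suf_sum_def suf_prod_def)

section \<open>Closed formulas for the variables after \<open>tau\<close>\<close>

context mid_cycle_seed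
begin

lemma prod_gain_1:
  assumes "1 \<le> p" "p \<le> q" "q \<le> n"
  shows "(\<Prod>k=p..<q. gain n Y 1 k) = (\<Prod>k=p + 1..q. Y k) * tot n Y (Suc q) / tot n Y (Suc p)"
  using assms(2,3)
proof (induction rule: dec_induct)
  case base
  then show ?case using nonzero(4)[of "Suc p"] by simp
next
  case (step q)
  then show ?case
    using nonzero(4)[of "Suc q"] assms(1)
      gain_1[of q]
    by simp
qed

lemma tau_var_arc:
  assumes v: "v \<notin> Mid ` {1..n}" and pq: "1 \<le> d" "d \<le> e" "e \<le> n"
    and row: "\<And>j. j \<in> {1..n} \<Longrightarrow> arr s v (Mid j) = of_bool (j = d) - of_bool (j = e)"
  shows "snd (tau n s) v = snd s v *
        (((\<Sum>j=e..n-1. \<Prod>k=d+1..j. Y k)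
          + (\<Prod>k=d+1..n. Y k) * (\<Sum>j=0..e-1. \<Prod>k=0..j. Y k)) /
         ((\<Sum>j=d+1..n. \<Prod>k=d+1..<j. Y k)
          + (\<Prod>k=d+1..n. Y k) * (\<Sum>j=0..d-1. \<Prod>k=0..j. Y k)))"
proof -
  note row_arc = row_arc[OF v pq row]
  have "snd (tau n s) v = snd s v * (\<Prod>k=1..n - 1. gain n Y (arr (up s (k - 1)) v (Mid k)) k)"
    by (intro tau_frozen_var[OF v])
      (use n row_arc arc_row_top[OF pq n] in auto)
  also have "(\<Prod>k=1..n - 1. gain n Y (arr (up s (k - 1)) v (Mid k)) k) =
      (\<Prod>k=1..n - 1. if k \<in> {d..<e} then gain n Y 1 k else 1)"
  proof (intro prod.cong refl)
    fix k assume k: "k \<in> {1..n - 1}"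
    then show "gain n Y (arr (up s (k - 1)) v (Mid k)) k = (if k \<in> {d..<e} then gain n Y 1 k else 1)"
      using row_arc[of "k - 1" k] arc_row_diag[OF pq(1,2), of "k - 1"]
      by auto
  qed
  also have "\<dots> = (\<Prod>k=d..<e. gain n Y 1 k)"
    unfolding prod.inter_restrict[symmetric, OF finite_atLeastAtMost]
    by (intro prod.cong) (use pq in auto)
  also have "\<dots> = (\<Prod>k=d + 1..e. Y k) * tot n Y (Suc e) / tot n Y (Suc d)"
    by (rule prod_gain_1[OF pq])
  finally have *: "snd (tau n s) v = snd s v * ((\<Prod>k=d + 1..e. Y k) * tot n Y (Suc e) / tot n Y (Suc d))" .
  have de: "d + 1 \<le> Suc e" "1 \<le> e" using pq by simp_all
  show ?thesis
    unfolding * tot_denominator[OF pq(1)] tot_numerator[OF de pq(3)] by simp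
qed

lemma tau_var_wrap:
  assumes v: "v \<notin> Mid ` {1..n}" and pq: "1 \<le> d" "d < e" "e \<le> n"
    and row: "\<And>j. j \<in> {1..n} \<Longrightarrow> arr s v (Mid j) = of_bool (j = e) - of_bool (j = d)"
  shows "snd (tau n s) v = snd s v *
        (((\<Prod>k=e+1..n. Y k) *
           ((\<Sum>j=d..n-1. \<Prod>k=0..j. Y k)
            + (\<Prod>k=0..n. Y k) * (\<Sum>j=0..d-1. \<Prod>k=0..j. Y k))) /
         ((\<Sum>j=e+1..n. \<Prod>k=e+1..<j. Y k)
          + (\<Prod>k=e+1..n. Y k) * (\<Sum>j=0..e-1. \<Prod>k=0..j. Y k)))"
proof -
  note row_wrap = row_wrap[OF v pq row]
  have e: "1 \<le> e" and "d \<in> {1..n - 1}" using pq by simp_all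
  have "snd (tau n s) v = snd s v * (\<Prod>k=1..n - 1. gain n Y (arr (up s (k - 1)) v (Mid k)) k)"
    by (intro tau_frozen_var[OF v])
      (use n row_wrap pq arc_row_top[OF e pq(3) order.refl n] in auto)
  also have "(\<Prod>k=1..n - 1. gain n Y (arr (up s (k - 1)) v (Mid k)) k) =
      (\<Prod>k=1..n - 1. (if k \<in> {e..<n} then gain n Y 1 k else 1) * (if k = d then gain n Y (- 1) k else 1))"
  proof (intro prod.cong refl)
    fix k assume k: "k \<in> {1..n - 1}"
    then have "arr (up s (k - 1)) v (Mid k) = of_bool (e \<le> k \<and> k < n) - of_bool (k = d)"
      using row_wrap[of "k - 1" k] arc_row_diag[OF e pq(3), of "k - 1"] by auto
    then show "gain n Y (arr (up s (k - 1)) v (Mid k)) k =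
      (if k \<in> {e..<n} then gain n Y 1 k else 1) * (if k = d then gain n Y (- 1) k else 1)"
      using pq by auto
  qed
  also have "\<dots> = (\<Prod>k=1..n - 1. if k \<in> {e..<n} then gain n Y 1 k else 1) * gain n Y (- 1) d"
    using \<open>d \<in> {1..n - 1}\<close> by (simp add: prod.distrib)
  also have "(\<Prod>k=1..n - 1. if k \<in> {e..<n} then gain n Y 1 k else 1) = (\<Prod>k=e..<n. gain n Y 1 k)"
    unfolding prod.inter_restrict[symmetric, OF finite_atLeastAtMost]
    by (intro prod.cong) (use pq in auto)
  also have "\<dots> = (\<Prod>k=e + 1..n. Y k) * pre_sum Y n / tot n Y (Suc e)"
    using prod_gain_1[of e n] pq by (simp add: tot_Suc_n)
  also have "gain n Y (- 1) d = pre_prod Y d * tot n Y (Suc d) / pre_sum Y n"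
    by (intro gain_minus_1) (use pq in auto)
  \<comment> \<open>The sum \<open>pre_sum Y n\<close> from the telescoped product cancels the
    denominator of the gain at \<open>d\<close>.\<close>
  finally have *: "snd (tau n s) v =
      snd s v * ((\<Prod>k=e + 1..n. Y k) * (pre_prod Y d * tot n Y (Suc d)) / tot n Y (Suc e))"
    using nonzero(3)[of n] pq by simp
  have "d \<le> n" using pq by simp
  then show ?thesis
    unfolding * tot_denominator[OF e] tot_numerator[OF le0 pq(1) \<open>d \<le> n\<close>] pre_prod_def by simp
qed

lemma tau_var_none:
  assumes v: "v \<notin> Mid ` {1..n}" and row: "\<And>j. j \<in> {1..n} \<Longrightarrow> arr s v (Mid j) = 0"
  shows "snd (tau n s) v = snd s v"
proof -
  \<comment> \<open>A zero row is an arc with \<open>p = q = 1\<close>, which stays zero.\<close>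
  have row': "arr s v (Mid j) = of_bool (j = 1) - of_bool (j = 1)" if "j \<in> {1..n}" for j
    using row that by simp
  have *: "arr (up s t) v (Mid j) = 0" if "t \<le> n - 2" "j \<in> {1..n}" for t j
    using row_arc[OF v order.refl order.refl _ row' that] n arc_row_after[of 1 1 t j] by simp
  have "snd (tau n s) v = snd s v * (\<Prod>k=1..n - 1. gain n Y (arr (up s (k - 1)) v (Mid k)) k)"
    by (intro tau_frozen_var[OF v]) (use n * in auto)
  also have "\<dots> = snd s v * (\<Prod>k=1..n - 1. 1)"
    using * by (intro arg_cong2[of _ _ _ _ "(*)"] prod.cong refl) auto
  finally show ?thesis by simp
qed

lemma tau_var_mid:
  assumes "i \<in> {1..n - 1}"
  shows "snd (tau n s) (Mid i) =
        ((\<Sum>j=i..n. \<Prod>k=i..<j. Y k)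
         + (\<Prod>k=i..n. Y k) * (\<Sum>j=0..<i-1. \<Prod>k=0..j. Y k)) /
        ((\<Sum>j=i+1..n-1. \<Prod>k=i+1..j. Y k)
         + (\<Prod>k=i+1..n. Y k) * (\<Sum>j=0..i. \<Prod>k=0..j. Y k))"
proof -
  have "snd (tau n s) (Mid i) = tot n Y i / (Y (Suc i) * tot n Y (i + 2))"
  proof (cases "i = 1")
    \<comment> \<open>Vertex 1 lies in the branch \<open>i = Suc t\<close> of
      \<open>down_var\<close>; \<open>pre_sum Y 1 = 1\<close> and \<open>tot_1\<close> bring it to
      the common form.\<close>
    case True
    then show ?thesis
      using down_mid_var[of 0 i] assms n Y0 tot_1[of Y n]
      by (simp add: tau_eq_down down_var_def pre_sum_def[of Y "Suc 0"] pre_prod_def numeral_3_eq_3)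
  next
    case False
    then show ?thesis
      using down_mid_var[of 0 i] assms
      by (auto simp: tau_eq_down down_var_def)
  qed
  moreover have "(\<Sum>j=0..<i-1. \<Prod>k=0..j. Y k) = pre_sum Y (i - 1)"
    by (simp add: pre_sum_def pre_prod_def atLeast0LessThan)
  moreover have "(\<Sum>j=i+1..n-1. \<Prod>k=i+1..j. Y k)
         + (\<Prod>k=i+1..n. Y k) * (\<Sum>j=0..i. \<Prod>k=0..j. Y k) = Y (Suc i) * tot n Y (i + 2)"
    using tot_numerator[of "i + 1" "i + 1" n Y] assms by force
  ultimately show ?thesis
    by (simp add: tot_def suf_sum_def suf_prod_def)
qed

lemma tau_var_mid_n:
  "snd (tau n s) (Mid n) =
        (1 + Y n * (\<Sum>j=0..n-2. \<Prod>k=0..j. Y k)) /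
        ((\<Sum>j=1..n-1. \<Prod>k=1..j. Y k) + (\<Prod>k=1..n. Y k))"
proof -
  have "snd (tau n s) (Mid n) = tot n Y n / (Y 1 * tot n Y 2)"
    using down_mid_var[of 0 n] n Y0
    by (simp add: tau_eq_down down_var_def pre_sum_def[of Y "Suc 0"] pre_prod_def numeral_2_eq_2)
  moreover have "(\<Sum>j=0..n-2. \<Prod>k=0..j. Y k) = pre_sum Y (n - 1)"
    using pre_sum_atLeastAtMost[of "n - 1" Y] n by (simp add: numeral_2_eq_2)
  moreover have "(\<Sum>j=1..n-1. \<Prod>k=1..j. Y k) + (\<Prod>k=1..n. Y k) = Y 1 * tot n Y 2"
    using tot_numerator[of 1 1 n Y] n Y0 by (simp add: numeral_2_eq_2)
  ultimately show ?thesis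
    by (simp add: tot_def suf_sum_def suf_prod_def)
qed

end

section \<open>The arrows between two circles\<close>

lemma directed_cycle_count:
  assumes "directed_cycle F"
  shows "count (image_mset fst F) x \<le> 1" "count (image_mset snd F) x \<le> 1"
proof -
  obtain vs where vs: "distinct vs" "F = mset (zip vs (rotate1 vs))"
    using assms by (auto simp: directed_cycle_def)
  have "image_mset fst F = mset vs" "image_mset snd F = mset (rotate1 vs)"
    by (simp_all add: vs(2) flip: mset_map)
  then show "count (image_mset fst F) x \<le> 1" "count (image_mset snd F) x \<le> 1"
    using vs(1) distinct_count_atmost_1[of vs] distinct_count_atmost_1[of "rotate1 vs"] by auto
qed

lemma pos_add [simp]: "pos N C (p + N) = pos N C p"
  by (simp add: pos_def)

text \<open>A nonempty side on \<open>A\<close> leaves position \<open>a k\<close> and arrives at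
  \<open>a (Suc k)\<close>. So the first spoke must arrive at \<open>A\<close> and the second must
  leave it, or two arrows would share a source or a target; a full turn would enter position
  \<open>a k\<close> twice.\<close>

lemma directed_face:
  assumes "directed_cycle (face N A M B a b to_B k)" "a k < a (Suc k)" "N > 0"
  shows "\<not> to_B k \<and> to_B (Suc k) \<and> a (Suc k) < a k + N"
proof -
  let ?F = "face N A M B a b to_B k" and ?X = "arc N A (a k) (a (Suc k))"
  note count = directed_cycle_count[OF assms(1)]
  have out_arc: "pos N A r \<in># image_mset fst ?X" if "a k \<le> r" "r < a (Suc k)" for r
    using that by (auto simp: arc_def image_iff)
  have in_arc: "pos N A (Suc r) \<in># image_mset snd ?X" if "a k \<le> r" "r < a (Suc k)" for r
    using that by (auto simp: arc_def image_iff)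
  have out2: False if "fst (spoke N A M B a b to_B k) = x" "x \<in># image_mset fst ?X" for x
  proof -
    note hyps = that
    obtain c where "count (image_mset fst ?X) x = Suc c"
      using hyps(2) by (metis count_greater_zero_iff gr0_conv_Suc)
    then show False
      using count(1)[of x] unfolding face_def by (simp add: hyps(1) split: if_splits)
  qed
  have in2: False
    if "snd (spoke N A M B a b to_B l) = x" "x \<in># image_mset snd ?X" "l = k \<or> l = Suc k" for x l
  proof -
    note hyps = that
    obtain c where "count (image_mset snd ?X) x = Suc c"
      using hyps(2) by (metis count_greater_zero_iff gr0_conv_Suc)
    then show False
      using count(2)[of x] hyps(1,3) unfolding face_def by (auto split: if_splits)
  qed
  have 1: "\<not> to_B k"
    using out2[OF _ out_arc[of "a k"]] assms(2) by (auto simp: spoke_def)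
  have "to_B (Suc k)"
  proof (rule ccontr)
    assume "\<not> to_B (Suc k)"
    moreover have "a k \<le> a (Suc k) - 1" using assms(2) by simp
    ultimately show False
      using in2[OF _ in_arc[of "a (Suc k) - 1"], of "Suc k"] assms(2) by (simp add: spoke_def)
  qed
  moreover have "a (Suc k) < a k + N"
  proof (rule ccontr)
    assume "\<not> ?thesis"
    then have "pos N A (a k) \<in># image_mset snd ?X"
      using in_arc[of "a k + N - 1"] assms(3) by simp
    then show False using in2[of k] 1 by (simp add: spoke_def)
  qed
  ultimately show ?thesis using 1 by simp
qed

lemma spoke_flip: "spoke M B N A b a (\<lambda>k. \<not> to_B k) k = spoke N A M B a b to_B k"
  by (simp add: spoke_def)

lemma face_flip: "face M B N A b a (\<lambda>k. \<not> to_B k) k = face N A M B a b to_B k"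
  unfolding face_def spoke_flip add.assoc by (rule arg_cong[OF add.commute])

lemma annulusE:
  assumes "annulus N A M B S"
  obtains L a b to_B where "L > 0" "\<forall>k<L. a k \<le> a (Suc k) \<and> b k \<le> b (Suc k)"
    "a L = a 0 + N" "b L = b 0 + M" "to_B L = to_B 0"
    "\<forall>k<L. directed_cycle (face N A M B a b to_B k) \<and> size (face N A M B a b to_B k) \<ge> 3"
    "S = image_mset (spoke N A M B a b to_B) (mset_set {0..<L})"
  using assms unfolding annulus_def by (elim exE conjE) (rule that)

lemma annulusI:
  assumes "L > 0" "\<forall>k<L. a k \<le> a (Suc k) \<and> b k \<le> b (Suc k)"
    "a L = a 0 + N" "b L = b 0 + M" "to_B L = to_B 0"
    "\<forall>k<L. directed_cycle (face N A M B a b to_B k) \<and> size (face N A M B a b to_B k) \<ge> 3"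
    "S = image_mset (spoke N A M B a b to_B) (mset_set {0..<L})"
  shows "annulus N A M B S"
  unfolding annulus_def
  by (rule exI[of _ L], rule exI[of _ a], rule exI[of _ b], rule exI[of _ to_B], intro conjI assms)

text \<open>Reversing the reading of \<open>to_B\<close> exchanges the circles, so the inner circle
  can be treated like the outer one.\<close>

lemma annulus_flip:
  assumes "annulus N A M B S"
  shows "annulus M B N A S"
proof -
  obtain L a b to_B where *: "L > 0" "\<forall>k<L. a k \<le> a (Suc k) \<and> b k \<le> b (Suc k)"
     "a L = a 0 + N" "b L = b 0 + M" "to_B L = to_B 0"
     "\<forall>k<L. directed_cycle (face N A M B a b to_B k) \<and> size (face N A M B a b to_B k) \<ge> 3"
     "S = image_mset (spoke N A M B a b to_B) (mset_set {0..<L})"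
    by (rule annulusE[OF assms])
  have "spoke M B N A b a (\<lambda>k. \<not> to_B k) = spoke N A M B a b to_B"
    by (rule ext) (rule spoke_flip)
  then show ?thesis
    using * by (intro annulusI[where L = L and a = b and b = a and to_B = "\<lambda>k. \<not> to_B k"]) (auto simp: face_flip)
qed

text \<open>Three sides require a circle edge, and edges on both circles would demand opposite
  directions of spoke \<open>k\<close>. So exactly one circle advances.\<close>

lemma face_step:
  assumes "directed_cycle (face N A M B a b to_B k)" "size (face N A M B a b to_B k) \<ge> 3"
    and "a k \<le> a (Suc k)" "b k \<le> b (Suc k)" and "N > 0" "M > 0"
  shows "(\<not> to_B k \<and> to_B (Suc k) \<and> a k < a (Suc k) \<and> a (Suc k) < a k + N \<and> b (Suc k) = b k) \<or>
    (to_B k \<and> \<not> to_B (Suc k) \<and> b k < b (Suc k) \<and> b (Suc k) < b k + M \<and> a (Suc k) = a k)"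
proof -
  have "a k < a (Suc k) \<or> b k < b (Suc k)"
    using assms(2) assms(3,4) by (auto simp: face_def arc_def)
  moreover have "a k < a (Suc k) \<Longrightarrow> \<not> to_B k \<and> to_B (Suc k) \<and> a (Suc k) < a k + N"
    using directed_face[OF assms(1)] assms(5) by blast
  moreover have "b k < b (Suc k) \<Longrightarrow> to_B k \<and> \<not> to_B (Suc k) \<and> b (Suc k) < b k + M"
    using directed_face[of M B N A b a "\<lambda>k. \<not> to_B k" k] assms(1,6) by (simp add: face_flip)
  ultimately show ?thesis using assms(3,4) by linarith
qed

lemma annulus_periodic:
  assumes "annulus N A M B S" and NM: "N > 0" "M > 0"
  obtains L a b to_B where "L > 0" "\<And>k. a (k + L) = a k + N" "\<And>k. b (k + L) = b k + M"
    "\<And>k. to_B (k + L) = to_B k"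
    "\<And>k. (\<not> to_B k \<and> to_B (Suc k) \<and> a k < a (Suc k) \<and> a (Suc k) < a k + N \<and> b (Suc k) = b k) \<or>
      (to_B k \<and> \<not> to_B (Suc k) \<and> b k < b (Suc k) \<and> b (Suc k) < b k + M \<and> a (Suc k) = a k)"
    "\<And>m. S = image_mset (spoke N A M B a b to_B) (mset_set {m..<m + L})"
proof -
  obtain L a b to_B where *: "L > 0" "\<forall>k<L. a k \<le> a (Suc k) \<and> b k \<le> b (Suc k)"
     "a L = a 0 + N" "b L = b 0 + M" "to_B L = to_B 0"
     "\<forall>k<L. directed_cycle (face N A M B a b to_B k) \<and> size (face N A M B a b to_B k) \<ge> 3"
     "S = image_mset (spoke N A M B a b to_B) (mset_set {0..<L})"
    by (rule annulusE[OF assms(1)])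
  \<comment> \<open>Periodic extension to all indices allows the numbering to start at any
    spoke.\<close>
  define a' b' to' where "a' = (\<lambda>k. a (k mod L) + k div L * N)"
    and "b' = (\<lambda>k. b (k mod L) + k div L * M)" and "to' = (\<lambda>k. to_B (k mod L))"
  \<comment> \<open>The case \<open>i = L\<close> is included for the face across the seam; there
    the closing conditions make both readings agree.\<close>
  have ext: "a' (c * L + i) = a i + c * N" "b' (c * L + i) = b i + c * M" "to' (c * L + i) = to_B i"
    if "i \<le> L" for c i
  proof -
    have "(c * L + i) mod L = (if i = L then 0 else i)"
      "(c * L + i) div L = (if i = L then Suc c else c)"
      using that * by auto
    then show "a' (c * L + i) = a i + c * N" "b' (c * L + i) = b i + c * M" "to' (c * L + i) = to_B i"
      using * by (auto simp: a'_def b'_def to'_def)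
  qed
  have per: "a' (k + L) = a' k + N" "b' (k + L) = b' k + M" "to' (k + L) = to' k" for k
    using *(1) by (simp_all add: a'_def b'_def to'_def)
  have step: "(\<not> to' k \<and> to' (Suc k) \<and> a' k < a' (Suc k) \<and> a' (Suc k) < a' k + N \<and> b' (Suc k) = b' k) \<or>
      (to' k \<and> \<not> to' (Suc k) \<and> b' k < b' (Suc k) \<and> b' (Suc k) < b' k + M \<and> a' (Suc k) = a' k)" for k
  proof -
    define c i where "c = k div L" and "i = k mod L"
    have k: "k = c * L + i" "Suc k = c * L + Suc i" and i: "i < L"
      using *(1) by (auto simp: c_def i_def)
    show ?thesis
      unfolding k using ext[of i c] ext[of "Suc i" c] i face_step[of N A M B a b to_B i] * NM by auto
  qed
  have spoke_per: "spoke N A M B a' b' to' (k + L) = spoke N A M B a' b' to' k" for k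
    by (simp add: spoke_def per)
  have "S = image_mset (spoke N A M B a' b' to') (mset_set {m..<m + L})" for m
  proof (induction m)
    case 0
    show ?case
      unfolding *(7) add_0 by (intro image_mset_cong) (use ext[of _ 0] in \<open>simp add: spoke_def\<close>)
  next
    case (Suc m)
    have "{m..<m + L} = insert m {Suc m..<m + L}" "{Suc m..<Suc m + L} = insert (m + L) {Suc m..<m + L}"
      using *(1) by auto
    then show ?case
      using Suc spoke_per[of m] by simp
  qed
  then show thesis
    using that[of L a' b' to'] *(1) per step by blast
qed

lemma image_mset_pairs:
  "image_mset h (mset_set {m..<m + 2 * r}) = (\<Sum>t<r. {# h (m + 2 * t), h (Suc (m + 2 * t)) #})"
proof (induction r)
  case (Suc r)
  have "{m..<m + 2 * Suc r} = insert (Suc (m + 2 * r)) (insert (m + 2 * r) {m..<m + 2 * r})"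
    by auto
  then show ?case using Suc by (simp add: add_mset_commute)
qed simp

lemma annulus_zigzag:
  assumes "annulus N A M B S" and NM: "N > 0" "M > 0"
  obtains r p q where "r \<ge> 2" "strict_mono p" "strict_mono q"
    "\<And>t. p (t + r) = p t + N" "\<And>t. q (t + r) = q t + M"
    "\<And>m. S = (\<Sum>t<r. {# (pos N A (p (m + t)), pos M B (q (m + t))),
      (pos M B (q (Suc (m + t))), pos N A (p (m + t))) #})"
proof -
  from assms obtain L a b to_B where L: "L > 0"
    and per: "\<And>k. a (k + L) = a k + N" "\<And>k. b (k + L) = b k + M" "\<And>k. to_B (k + L) = to_B k"
    and step: "\<And>k. (\<not> to_B k \<and> to_B (Suc k) \<and> a k < a (Suc k) \<and> a (Suc k) < a k + N \<and> b (Suc k) = b k) \<or>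
      (to_B k \<and> \<not> to_B (Suc k) \<and> b k < b (Suc k) \<and> b (Suc k) < b k + M \<and> a (Suc k) = a k)"
    and S: "\<And>m. S = image_mset (spoke N A M B a b to_B) (mset_set {m..<m + L})"
    by (rule annulus_periodic) blast
  obtain s where s: "to_B s"
    using step[of 0] by blast
  have alt: "to_B (s + k) \<longleftrightarrow> even k" for k
  proof (induction k)
    case (Suc k)
    then show ?case using step[of "s + k"] by auto
  qed (use s in simp)
  then have "even L" using per(3)[of s] s by simp
  then obtain r where r: "L = 2 * r" by blast
  \<comment> \<open>Spokes \<open>s + 2 * t\<close> and \<open>Suc (s + 2 * t)\<close> share
    position \<open>p t\<close> of \<open>A\<close>: one leaves for \<open>q t\<close>, the other
    arrives from \<open>q (Suc t)\<close>.\<close>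
  define p q where "p = (\<lambda>t. a (s + 2 * t))" and "q = (\<lambda>t. b (s + 2 * t))"
  have mid: "a (Suc (s + 2 * t)) = p t" "b (Suc (s + 2 * t)) = q (Suc t)"
    and mono: "p t < p (Suc t)" "q t < q (Suc t)" "q (Suc t) < q t + M" for t
    using step[of "s + 2 * t"] step[of "Suc (s + 2 * t)"] alt[of "2 * t"] alt[of "Suc (2 * t)"]
    by (auto simp: p_def q_def)
  have per': "p (t + r) = p t + N" "q (t + r) = q t + M" for t
    using per(1,2)[of "s + 2 * t"] by (simp_all add: p_def q_def r algebra_simps)
  \<comment> \<open>A single pair would make \<open>q\<close> go fully around in one face.\<close>
  have "r \<noteq> 1" using mono(3)[of 0] per'(2)[of 0] by auto
  then have "r \<ge> 2" using L r by simp
  moreover have "S = (\<Sum>t<r. {# (pos N A (p (m + t)), pos M B (q (m + t))),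
      (pos M B (q (Suc (m + t))), pos N A (p (m + t))) #})" for m
    unfolding S[of "s + 2 * m"] r image_mset_pairs
  proof (intro sum.cong refl)
    fix t
    have "s + 2 * m + 2 * t = s + 2 * (m + t)" by simp
    then show "{#spoke N A M B a b to_B (s + 2 * m + 2 * t), spoke N A M B a b to_B (Suc (s + 2 * m + 2 * t))#} =
      {# (pos N A (p (m + t)), pos M B (q (m + t))), (pos M B (q (Suc (m + t))), pos N A (p (m + t))) #}"
      using mid[of "m + t"] alt[of "2 * (m + t)"] alt[of "Suc (2 * (m + t))"]
      by (simp only: spoke_def) (simp add: p_def q_def)
  qed
  ultimately show thesis
    using that[of r p q] mono per' by (simp add: strict_mono_Suc_iff)
qed

lemma annulus_normal_form:
  assumes "annulus N A n Mid S" and pos: "N > 0" "n > 0"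
  obtains r x p where "r \<ge> 2" "\<And>t. t < r \<Longrightarrow> x t \<in> {1..n}" "\<And>t u. t < u \<Longrightarrow> u < r \<Longrightarrow> x t < x u"
    "strict_mono p" "p r = p 0 + N"
    "S = (\<Sum>t<r. {# (A (p t mod N + 1), Mid (x t)), (Mid (x (Suc t mod r)), A (p t mod N + 1)) #})"
proof -
  obtain r p q where r: "r \<ge> 2" and mono: "strict_mono p" "strict_mono q"
    and per: "\<And>t. p (t + r) = p t + N" "\<And>t. q (t + r) = q t + n"
    and S: "\<And>m. S = (\<Sum>t<r. {# (pos N A (p (m + t)), pos n Mid (q (m + t))),
      (pos n Mid (q (Suc (m + t))), pos N A (p (m + t))) #})"
    using annulus_zigzag[OF assms] by blast
  \<comment> \<open>Numbering starts at the connected middle vertex of least label, so that labels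
    increase through one turn.\<close>
  obtain m where m: "\<And>t. q m mod n \<le> q t mod n"
    using ex_has_least_nat[of "\<lambda>_. True" 0 "\<lambda>t. q t mod n"] by auto
  define c where "c = n * (q m div n)"
  have qm: "q m = c + q m mod n" by (simp add: c_def)
  have le: "c \<le> q (m + t)" for t
  proof -
    have "c \<le> q m" using qm by linarith
    also have "\<dots> \<le> q (m + t)" using mono(2) by (simp add: strict_mono_less_eq)
    finally show ?thesis .
  qed
  have mod: "q (m + t) mod n = (q (m + t) - c) mod n" for t
  proof -
    have "q (m + t) = q (m + t) - c + n * (q m div n)" using le[of t] by (simp add: c_def)
    then show ?thesis by (metis mod_mult_self2)
  qed
  define x where "x = (\<lambda>t. q (m + t) - c + 1)"
  \<comment> \<open>A value of at least \<open>n\<close> would leave a residue smaller than that of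
    \<open>q m\<close>, because \<open>q (m + t) < q m + n\<close>.\<close>
  have lt: "q (m + t) - c < n" if "t < r" for t
  proof (rule ccontr)
    assume *: "\<not> ?thesis"
    have "q (m + t) < q (m + r)" using mono(2) that by (simp add: strict_mono_less)
    also have "\<dots> = q m + n" by (rule per)
    finally have **: "q (m + t) - c - n < q m mod n" using qm * pos by arith
    also have "\<dots> < n" using pos by simp
    finally have "(q (m + t) - c - n) mod n = q (m + t) - c - n" by simp
    then have "q (m + t) mod n = q (m + t) - c - n"
      using * mod[of t] by (simp add: le_mod_geq)
    then show False using m[of "m + t"] ** by simp
  qed
  have posx: "pos n Mid (q (m + t)) = Mid (x t)" if "t < r" for t
    using lt[OF that] mod[of t] by (simp add: pos_def x_def)
  have posx': "pos n Mid (q (Suc (m + t))) = Mid (x (Suc t mod r))" if "t < r" for t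
  proof (cases "Suc t = r")
    case True
    then have "Suc (m + t) = m + r" by simp
  then have "q (Suc (m + t)) = q m + n" using per(2)[of m] by metis
    then show ?thesis using posx[of 0] r True by simp
  next
    case False
    then show ?thesis using posx[of "Suc t"] that by simp
  qed
  have "S = (\<Sum>t<r. {# (A (p (m + t) mod N + 1), Mid (x t)),
      (Mid (x (Suc t mod r)), A (p (m + t) mod N + 1)) #})"
    unfolding S[of m] using posx posx' by (intro sum.cong refl) (simp add: pos_def)
  moreover have "x t < x u" if "t < u" "u < r" for t u
    using mono(2) that le[of t] by (simp add: x_def strict_mono_less diff_less_mono)
  moreover have "x t \<in> {1..n}" if "t < r" for t using lt[OF that] by (simp add: x_def)
  moreover have "strict_mono (\<lambda>t. p (m + t))"
    using mono(1) by (simp add: strict_mono_def)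
  ultimately show thesis
    using that[of r x "\<lambda>t. p (m + t)"] r per(1)[of m] by simp
qed

lemma mid_nbrs_arrows:
  assumes "reduced Q"
  shows "mid_nbrs n Q v = {j \<in> {1..n}. arrows Q v (Mid j) \<noteq> 0}"
proof -
  have "Q v w > 0 \<or> Q w v > 0 \<longleftrightarrow> arrows Q v w \<noteq> 0" for w
    using assms[unfolded reduced_def, rule_format, of v w] by (auto simp: arrows_def)
  then show ?thesis by (simp add: mid_nbrs_def)
qed

text \<open>The \<open>t\<close>-th connected vertex has an arrow to \<open>x t\<close> and one from
  the cyclically next \<open>x\<close>. The choice of label 1 makes labels increase with
  \<open>t\<close>, so only the vertex of maximal label wraps back to \<open>x 0\<close>, which
  reverses the roles of minimum and maximum.\<close>

lemma circle_rows:
  assumes ann: "annulus N A n Mid S" and Nn: "N \<ge> 2" "n \<ge> 2" and A: "inj A" "\<And>i j. A i \<noteq> Mid j"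
    and red: "reduced Q"
    and Q: "\<And>i j. arrows Q (A i) (Mid j) = int (count S (A i, Mid j)) - int (count S (Mid j, A i))"
    and one: "Q (A 1) (Mid (Min (\<Union>i\<in>{1..N}. mid_nbrs n Q (A i)))) > 0"
    and i: "i \<in> {1..N}"
  defines "d \<equiv> \<lambda>i. Min (mid_nbrs n Q (A i))" and "e \<equiv> \<lambda>i. Max (mid_nbrs n Q (A i))"
  shows "mid_nbrs n Q (A i) = {} \<Longrightarrow> j \<in> {1..n} \<Longrightarrow> arrows Q (A i) (Mid j) = 0"
    and "mid_nbrs n Q (A i) \<noteq> {} \<Longrightarrow> 1 \<le> d i \<and> d i < e i \<and> e i \<le> n"
    and "mid_nbrs n Q (A i) \<noteq> {} \<Longrightarrow> i \<noteq> Max {i \<in> {1..N}. mid_nbrs n Q (A i) \<noteq> {}} \<Longrightarrow>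
      arrows Q (A i) (Mid j) = of_bool (j = d i) - of_bool (j = e i)"
    and "mid_nbrs n Q (A i) \<noteq> {} \<Longrightarrow> i = Max {i \<in> {1..N}. mid_nbrs n Q (A i) \<noteq> {}} \<Longrightarrow>
      d i = d 1 \<and> arrows Q (A i) (Mid j) = of_bool (j = e i) - of_bool (j = d i)"
proof -
  have Nn': "N > 0" "n > 0" using Nn by simp_all
  obtain r x p where r: "r \<ge> 2" and x: "\<And>t. t < r \<Longrightarrow> x t \<in> {1..n}"
    and xmono: "\<And>t u. t < u \<Longrightarrow> u < r \<Longrightarrow> x t < x u"
    and p: "strict_mono p" "p r = p 0 + N"
    and S: "S = (\<Sum>t<r. {# (A (p t mod N + 1), Mid (x t)), (Mid (x (Suc t mod r)), A (p t mod N + 1)) #})"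
    by (rule annulus_normal_form[OF ann Nn']) (rule that)
  define l where "l = (\<lambda>t. p t mod N + 1)"
  have xeq: "x t = x u \<longleftrightarrow> t = u" if "t < r" "u < r" for t u
    using xmono[of t u] xmono[of u t] that by (metis less_irrefl linorder_neqE_nat)
  have pr: "p t < p 0 + N" "p 0 \<le> p t" if "t < r" for t
    using p that by (metis strict_mono_less) (simp add: p(1) strict_mono_less_eq)
  have lneq: "l t \<noteq> l u" if "t < u" "u < r" for t u
  proof
    assume "l t = l u"
    moreover have "p t \<le> p u" using p(1) that by (simp add: strict_mono_less_eq)
    ultimately have "N dvd p u - p t"
      using mod_eq_dvd_iff_nat[of "p t" "p u" N] by (simp add: l_def)
    moreover have "0 < p u - p t" "p u - p t < N"
      using p(1) that pr[of u] pr[of t] by (auto simp: strict_mono_less)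
    ultimately show False by (simp add: nat_dvd_not_less)
  qed
  then have leq: "l t = l u \<longleftrightarrow> t = u" if "t < r" "u < r" for t u
    using that by (metis linorder_neqE_nat)
  have count1: "count S (A i, Mid j) = (\<Sum>t<r. of_bool (l t = i \<and> x t = j))"
    and count2: "count S (Mid j, A i) = (\<Sum>t<r. of_bool (l t = i \<and> x (Suc t mod r) = j))" for i j
    using A(2) by (auto simp: S count_sum l_def inj_eq[OF A(1)] of_bool_def A(2)[symmetric] intro!: sum.cong)
  have row: "arrows Q (A (l t)) (Mid j) = of_bool (j = x t) - of_bool (j = x (Suc t mod r))"
    if "t < r" for t j
  proof -
    have "(\<Sum>u<r. of_bool (l u = l t \<and> P u)) = (of_bool (P t) :: nat)" for P
    proof -
      have "(\<Sum>u<r. of_bool (l u = l t \<and> P u)) = (\<Sum>u<r. if u = t then of_bool (P t) else (0::nat))"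
        using leq that by (intro sum.cong) auto
      then show ?thesis using that by simp
    qed
    then show ?thesis by (simp add: Q count1 count2 eq_commute[of j])
  qed
  have row0: "arrows Q (A i) (Mid j) = 0" if "i \<notin> l ` {..<r}" for i j
  proof -
    have "(\<Sum>t<r. of_bool (l t = i \<and> P t)) = (0::nat)" for P
      using that by (intro sum.neutral) auto
    then show ?thesis by (simp add: Q count1 count2)
  qed
  have Sr: "Suc t mod r < r" for t using r by simp
  have Sne: "Suc t mod r \<noteq> t" if "t < r" for t
    using that r by (cases "Suc t = r") auto
  have nbrs: "mid_nbrs n Q (A (l t)) = {x t, x (Suc t mod r)}" if "t < r" for t
    using x[OF that] x[OF Sr, of t] xeq[OF that Sr, of t] Sne[OF that]
    by (auto simp: mid_nbrs_arrows[OF red] row[OF that])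
  have nbrs0: "mid_nbrs n Q (A i) = {}" if "i \<notin> l ` {..<r}" for i
    by (simp add: mid_nbrs_arrows[OF red] row0[OF that])
  have l: "l t \<in> {1..N}" for t
    using Nn mod_less_divisor[of N "p t"] by (simp add: l_def Suc_le_eq del: mod_less_divisor)
  have "Min (\<Union>i\<in>{1..N}. mid_nbrs n Q (A i)) = x 0"
  proof (rule Min_eqI)
    show "finite (\<Union>i\<in>{1..N}. mid_nbrs n Q (A i))" by (simp add: mid_nbrs_def)
    show "x 0 \<in> (\<Union>i\<in>{1..N}. mid_nbrs n Q (A i))"
      using nbrs[of 0] l[of 0] r by auto
    fix y assume "y \<in> (\<Union>i\<in>{1..N}. mid_nbrs n Q (A i))"
    then obtain i where "y \<in> mid_nbrs n Q (A i)" by blast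
    then obtain t where "t < r" "y \<in> {x t, x (Suc t mod r)}"
      using nbrs nbrs0 by (metis empty_iff imageE lessThan_iff)
    then obtain u where "u < r" "y = x u" using Sr[of t] by blast
    then show "x 0 \<le> y" using xmono[of 0 u] by (cases "u = 0") auto
  qed
  then have "Q (A 1) (Mid (x 0)) > 0" using one by simp
  then have pos: "arrows Q (A 1) (Mid (x 0)) > 0"
    using red[unfolded reduced_def, rule_format, of "A 1" "Mid (x 0)"] by (simp add: arrows_def)
  \<comment> \<open>Only the vertex \<open>A (l 0)\<close> has an arrow to \<open>x 0\<close>, so
    the label 1 must be \<open>l 0\<close>.\<close>
  then obtain t where t: "t < r" "l t = 1"
    using row0[of 1 "x 0"] by fastforce
  then have "x 0 = x t"
    using pos row[of t "x 0"] by (auto split: if_splits simp: of_bool_def)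
  then have l0: "l 0 = 1" using xeq[of 0 t] t r by auto
  \<comment> \<open>Since \<open>l 0 = 1\<close>, the position \<open>p 0\<close> is a multiple of
    \<open>N\<close>, and positions within one turn give the labels directly.\<close>
  have l_eq: "l t = p t - p 0 + 1" if "t < r" for t
  proof -
    obtain c where c: "p 0 = N * c" using l0 by (auto simp: l_def)
    have "p t = (p t - p 0) + N * c" using pr[OF that] c by simp
    then have "p t mod N = (p t - p 0) mod N" by (metis mod_mult_self2)
    also have "\<dots> = p t - p 0" using pr[OF that] by simp
    finally show ?thesis by (simp add: l_def)
  qed
  have nonempty: "{i \<in> {1..N}. mid_nbrs n Q (A i) \<noteq> {}} = l ` {..<r}"
    using nbrs nbrs0 l by auto
  have max: "Max (l ` {..<r}) = l (r - 1)"
  proof (rule Max_eqI)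
    show "l (r - 1) \<in> l ` {..<r}" using r by simp
    fix y assume "y \<in> l ` {..<r}"
    then obtain t where "t < r" "y = l t" by blast
    then show "y \<le> l (r - 1)"
      using l_eq[of t] l_eq[of "r - 1"] r p(1) by (simp add: strict_mono_less_eq diff_le_mono)
  qed simp
  show "arrows Q (A i) (Mid j) = 0" if "mid_nbrs n Q (A i) = {}" "j \<in> {1..n}"
    using that by (auto simp: mid_nbrs_arrows[OF red])
  have *: "\<exists>t<r. i = l t" if "mid_nbrs n Q (A i) \<noteq> {}"
    using that nbrs0 by blast
  have de: "d (l t) = x t \<and> e (l t) = x (Suc t)" if "Suc t < r" for t
    using that xmono[of t "Suc t"] nbrs[of t] by (simp add: d_def e_def)
  have de': "d (l (r - 1)) = x 0 \<and> e (l (r - 1)) = x (r - 1)"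
    using r xmono[of 0 "r - 1"] nbrs[of "r - 1"] by (simp add: d_def e_def)
  show "1 \<le> d i \<and> d i < e i \<and> e i \<le> n" if "mid_nbrs n Q (A i) \<noteq> {}"
  proof -
    from *[OF that] obtain t where t: "t < r" "i = l t" by blast
    show ?thesis
    proof (cases "Suc t < r")
      case True
      then show ?thesis using de[OF True] t x[of t] x[of "Suc t"] xmono[of t "Suc t"] by simp
    next
      case False
      then have "t = r - 1" using t by simp
      then show ?thesis using de' t x[of 0] x[of "r - 1"] xmono[of 0 "r - 1"] r by simp
    qed
  qed
  show "arrows Q (A i) (Mid j) = of_bool (j = d i) - of_bool (j = e i)"
    if "mid_nbrs n Q (A i) \<noteq> {}" "i \<noteq> Max {i \<in> {1..N}. mid_nbrs n Q (A i) \<noteq> {}}"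
  proof -
    from *[OF that(1)] obtain t where t: "t < r" "i = l t" by blast
    then have "t \<noteq> r - 1" using that(2)[unfolded nonempty max] by blast
    then have "Suc t < r" using t by simp
    then show ?thesis using row[OF t(1), of j] de t(2) by simp
  qed
  show "d i = d 1 \<and> arrows Q (A i) (Mid j) = of_bool (j = e i) - of_bool (j = d i)"
    if "mid_nbrs n Q (A i) \<noteq> {}" "i = Max {i \<in> {1..N}. mid_nbrs n Q (A i) \<noteq> {}}"
  proof -
    have i: "i = l (r - 1)" using that(2)[unfolded nonempty max] by simp
    have "d 1 = x 0" using de[of 0] l0 r by simp
    then show ?thesis using de' row[of "r - 1" j] r by (simp add: i)
  qed
qed

section \<open>The formulas for spider web quivers\<close>

lemma count_arc_other:
  assumes "u \<notin> range C \<or> w \<notin> range C"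
  shows "count (arc N C p q) (u, w) = 0"
  using assms by (auto simp: arc_def pos_def count_eq_zero_iff)

lemma count_arc_Mid:
  assumes "i \<in> {1..n}"
  shows "count (arc n Mid 0 n) (Mid i, Mid j) = of_bool (j = (if i = n then 1 else Suc i))"
proof -
  have "count (arc n Mid 0 n) (Mid i, Mid j) =
      card {r \<in> {0..<n}. (Mid (r mod n + 1), Mid (Suc r mod n + 1)) = (Mid i, Mid j)}"
    unfolding arc_def pos_def
    by (simp add: count_image_mset vimage_def Int_def conj_commute cong: conj_cong)
  also have "{r \<in> {0..<n}. (Mid (r mod n + 1), Mid (Suc r mod n + 1)) = (Mid i, Mid j)} =
      (if j = (if i = n then 1 else Suc i) then {i - 1} else {})"
    using assms by (auto split: if_splits)
  finally show ?thesis by simp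
qed

lemma annulus_arrow_ends:
  assumes "annulus N A M B S" "(u, w) \<in># S"
  shows "u \<in> range A \<and> w \<in> range B \<or> u \<in> range B \<and> w \<in> range A"
proof -
  obtain L a b to_B where "S = image_mset (spoke N A M B a b to_B) (mset_set {0..<L})"
    by (rule annulusE[OF assms(1)]) (rule that)
  then show ?thesis using assms(2) by (auto simp: spoke_def pos_def split: if_splits)
qed

lemma count_annulus_other:
  assumes "annulus N A M B S"
    "\<not> (u \<in> range A \<and> w \<in> range B \<or> u \<in> range B \<and> w \<in> range A)"
  shows "count S (u, w) = 0"
  using annulus_arrow_ends[OF assms(1)] assms(2) by (auto simp: count_eq_zero_iff)

text \<open>The five summands join different pairs of circles, so each of these signed counts sees
  only one of them.\<close>

lemma spider_web_arrows:
  assumes "spider_web N n M Q"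
  obtains S T where "annulus N Outer n Mid S" "annulus M Inner n Mid T" "reduced Q"
    "\<And>i j. i \<in> {1..n} \<Longrightarrow> j \<in> {1..n} \<Longrightarrow> arrows Q (Mid i) (Mid j) = mid_quiver n 0 i j"
    "\<And>i j. arrows Q (Outer i) (Mid j) = int (count S (Outer i, Mid j)) - int (count S (Mid j, Outer i))"
    "\<And>i j. arrows Q (Inner i) (Mid j) = int (count T (Inner i, Mid j)) - int (count T (Mid j, Inner i))"
proof -
  obtain S T where S: "annulus N Outer n Mid S" and T: "annulus n Mid M Inner T"
    and Q: "Q = remove_2cycles (\<lambda>u v. count
      (arc N Outer 0 N + arc n Mid 0 n + arc M Inner 0 M + S + T) (u, v))"
    using assms unfolding spider_web_def by blast
  note other = count_annulus_other[OF S] count_annulus_other[OF T] count_arc_other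
  have "arrows Q (Mid i) (Mid j) = mid_quiver n 0 i j" if "i \<in> {1..n}" "j \<in> {1..n}" for i j
    using that
    by (simp add: Q arrows_remove_2cycles other image_iff count_arc_Mid mid_quiver_def mid_arrow_def)
  moreover have
    "arrows Q (Outer i) (Mid j) = int (count S (Outer i, Mid j)) - int (count S (Mid j, Outer i))"
    "arrows Q (Inner i) (Mid j) = int (count T (Inner i, Mid j)) - int (count T (Mid j, Inner i))" for i j
    by (simp_all add: Q arrows_remove_2cycles other image_iff)
  moreover have "reduced Q" by (simp add: Q)
  ultimately show thesis
    using that[OF S annulus_flip[OF T]] by blast
qed

theorem theorem6p8:
  fixes N n M :: nat and Q Q' :: "vertex quiver"
    and P :: "'a::field set" and y y' :: "vertex \<Rightarrow> 'a" and Y :: "nat \<Rightarrow> 'a"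
    and d e f g :: "nat \<Rightarrow> nat"
  assumes "spider_web N n M Q"
    and "semifield_in P"
    and "\<forall>v \<in> web_vertices N n M. y v \<in> P"
    and "tau n (Q, y) = (Q', y')"
  defines "Y \<equiv> mid_var y"
    and "d \<equiv> \<lambda>i. Min (mid_nbrs n Q (Outer i))"
    and "e \<equiv> \<lambda>i. Max (mid_nbrs n Q (Outer i))"
    and "f \<equiv> \<lambda>i. Min (mid_nbrs n Q (Inner i))"
    and "g \<equiv> \<lambda>i. Max (mid_nbrs n Q (Inner i))"
  shows "
    (\<forall>i\<in>{1..n-1}. y' (Mid i) =
        ((\<Sum>j=i..n. \<Prod>k=i..<j. Y k)
         + (\<Prod>k=i..n. Y k) * (\<Sum>j=0..<i-1. \<Prod>k=0..j. Y k)) /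
        ((\<Sum>j=i+1..n-1. \<Prod>k=i+1..j. Y k)
         + (\<Prod>k=i+1..n. Y k) * (\<Sum>j=0..i. \<Prod>k=0..j. Y k))) \<and>
    (y' (Mid n) =
        (1 + Y n * (\<Sum>j=0..n-2. \<Prod>k=0..j. Y k)) /
        ((\<Sum>j=1..n-1. \<Prod>k=1..j. Y k) + (\<Prod>k=1..n. Y k))) \<and>
    (\<forall>i\<in>{1..N}. mid_nbrs n Q (Outer i) = {} \<longrightarrow> y' (Outer i) = y (Outer i)) \<and>
    (\<forall>i\<in>{1..N}. mid_nbrs n Q (Outer i) \<noteq> {} \<longrightarrow> i = Max {i \<in> {1..N}. mid_nbrs n Q (Outer i) \<noteq> {}} \<longrightarrow>
      y' (Outer i) = y (Outer i) *
        (((\<Prod>k=e i+1..n. Y k) *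
           ((\<Sum>j=d 1..n-1. \<Prod>k=0..j. Y k)
            + (\<Prod>k=0..n. Y k) * (\<Sum>j=0..d 1-1. \<Prod>k=0..j. Y k))) /
         ((\<Sum>j=e i+1..n. \<Prod>k=e i+1..<j. Y k)
          + (\<Prod>k=e i+1..n. Y k) * (\<Sum>j=0..e i-1. \<Prod>k=0..j. Y k)))) \<and>
    (\<forall>i\<in>{1..N}. mid_nbrs n Q (Outer i) \<noteq> {} \<longrightarrow> i \<noteq> Max {i \<in> {1..N}. mid_nbrs n Q (Outer i) \<noteq> {}} \<longrightarrow>
      y' (Outer i) = y (Outer i) *
        (((\<Sum>j=e i..n-1. \<Prod>k=d i+1..j. Y k)
          + (\<Prod>k=d i+1..n. Y k) * (\<Sum>j=0..e i-1. \<Prod>k=0..j. Y k)) /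
         ((\<Sum>j=d i+1..n. \<Prod>k=d i+1..<j. Y k)
          + (\<Prod>k=d i+1..n. Y k) * (\<Sum>j=0..d i-1. \<Prod>k=0..j. Y k)))) \<and>
    (\<forall>i\<in>{1..M}. mid_nbrs n Q (Inner i) = {} \<longrightarrow> y' (Inner i) = y (Inner i)) \<and>
    (\<forall>i\<in>{1..M}. mid_nbrs n Q (Inner i) \<noteq> {} \<longrightarrow> i = Max {i \<in> {1..M}. mid_nbrs n Q (Inner i) \<noteq> {}} \<longrightarrow>
      y' (Inner i) = y (Inner i) *
        (((\<Prod>k=g i+1..n. Y k) *
           ((\<Sum>j=f 1..n-1. \<Prod>k=0..j. Y k)
            + (\<Prod>k=0..n. Y k) * (\<Sum>j=0..f 1-1. \<Prod>k=0..j. Y k))) /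
         ((\<Sum>j=g i+1..n. \<Prod>k=g i+1..<j. Y k)
          + (\<Prod>k=g i+1..n. Y k) * (\<Sum>j=0..g i-1. \<Prod>k=0..j. Y k)))) \<and>
    (\<forall>i\<in>{1..M}. mid_nbrs n Q (Inner i) \<noteq> {} \<longrightarrow> i \<noteq> Max {i \<in> {1..M}. mid_nbrs n Q (Inner i) \<noteq> {}} \<longrightarrow>
      y' (Inner i) = y (Inner i) *
        (((\<Sum>j=g i..n-1. \<Prod>k=f i+1..j. Y k)
          + (\<Prod>k=f i+1..n. Y k) * (\<Sum>j=0..g i-1. \<Prod>k=0..j. Y k)) /
         ((\<Sum>j=f i+1..n. \<Prod>k=f i+1..<j. Y k)
          + (\<Prod>k=f i+1..n. Y k) * (\<Sum>j=0..f i-1. \<Prod>k=0..j. Y k))))"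
proof -
  have n: "n \<ge> 2" "N \<ge> 2" "M \<ge> 2"
    and one: "Q (Outer 1) (Mid (Min (\<Union>i\<in>{1..N}. mid_nbrs n Q (Outer i)))) > 0"
      "Q (Inner 1) (Mid (Min (\<Union>i\<in>{1..M}. mid_nbrs n Q (Inner i)))) > 0"
    using assms(1) by (simp_all add: spider_web_def)
  obtain S T where ST: "annulus N Outer n Mid S" "annulus M Inner n Mid T" and red: "reduced Q"
    and mid: "\<And>i j. i \<in> {1..n} \<Longrightarrow> j \<in> {1..n} \<Longrightarrow> arrows Q (Mid i) (Mid j) = mid_quiver n 0 i j"
    and Q: "\<And>i j. arrows Q (Outer i) (Mid j) = int (count S (Outer i, Mid j)) - int (count S (Mid j, Outer i))"
      "\<And>i j. arrows Q (Inner i) (Mid j) = int (count T (Inner i, Mid j)) - int (count T (Mid j, Inner i))"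
    by (rule spider_web_arrows[OF assms(1)]) (rule that)
  interpret web: mid_cycle_seed n P "(Q, y)" Y
  proof
    show "Y k \<in> P" if "k \<le> n" for k
      using that assms(2,3) by (auto simp: Y_def mid_var_def semifield_in_def web_vertices_def)
  qed (use n red mid assms(2) in \<open>simp_all add: Y_def mid_var_def\<close>)
  have y': "y' v = snd (tau n (Q, y)) v" for v using assms(4) by simp
  have inj: "inj Outer" "inj Inner" by (simp_all add: inj_def)
  have frozen: "Outer i \<notin> Mid ` {1..n}" "Inner i \<notin> Mid ` {1..n}" for i by auto
  note outer = circle_rows[OF ST(1) n(2,1) inj(1) _ red Q(1) one(1)]
  note inner = circle_rows[OF ST(2) n(3,1) inj(2) _ red Q(2) one(2)]
  have none: "y' v = y v" if "v \<notin> Mid ` {1..n}" "\<And>j. j \<in> {1..n} \<Longrightarrow> arrows Q v (Mid j) = 0" for v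
    using web.tau_var_none[OF that(1)] that(2) by (simp add: y')
  show ?thesis
  proof (intro conjI ballI impI)
    fix i assume "i \<in> {1..n-1}"
    then show "y' (Mid i) =
        ((\<Sum>j=i..n. \<Prod>k=i..<j. Y k)
         + (\<Prod>k=i..n. Y k) * (\<Sum>j=0..<i-1. \<Prod>k=0..j. Y k)) /
        ((\<Sum>j=i+1..n-1. \<Prod>k=i+1..j. Y k)
         + (\<Prod>k=i+1..n. Y k) * (\<Sum>j=0..i. \<Prod>k=0..j. Y k))"
      unfolding y' by (rule web.tau_var_mid)
  next
    show "y' (Mid n) =
        (1 + Y n * (\<Sum>j=0..n-2. \<Prod>k=0..j. Y k)) /
        ((\<Sum>j=1..n-1. \<Prod>k=1..j. Y k) + (\<Prod>k=1..n. Y k))"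
      unfolding y' by (rule web.tau_var_mid_n)
  next
    fix i assume "i \<in> {1..N}" "mid_nbrs n Q (Outer i) = {}"
    then show "y' (Outer i) = y (Outer i)"
      using outer(1) by (intro none frozen) simp
  next
    fix i assume i: "i \<in> {1..M}" "mid_nbrs n Q (Inner i) = {}"
    then show "y' (Inner i) = y (Inner i)"
      using inner(1) by (intro none frozen) simp
  next
    fix i assume i: "i \<in> {1..N}" "mid_nbrs n Q (Outer i) \<noteq> {}"
      "i = Max {i \<in> {1..N}. mid_nbrs n Q (Outer i) \<noteq> {}}"
    \<comment> \<open>The maximal vertex and vertex 1 share their least neighbour, which explains
      \<open>d 1\<close> in the formula.\<close>
    have *: "d i = d 1" "1 \<le> d i" "d i < e i" "e i \<le> n" 
      "\<And>j. arrows Q (Outer i) (Mid j) = of_bool (j = e i) - of_bool (j = d i)"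
      using outer(2)[OF _ i(1,2)] outer(4)[OF _ i] by (simp_all add: d_def e_def)
    show "y' (Outer i) = y (Outer i) *
        (((\<Prod>k=e i+1..n. Y k) *
           ((\<Sum>j=d 1..n-1. \<Prod>k=0..j. Y k)
            + (\<Prod>k=0..n. Y k) * (\<Sum>j=0..d 1-1. \<Prod>k=0..j. Y k))) /
         ((\<Sum>j=e i+1..n. \<Prod>k=e i+1..<j. Y k)
          + (\<Prod>k=e i+1..n. Y k) * (\<Sum>j=0..e i-1. \<Prod>k=0..j. Y k)))"
      using web.tau_var_wrap[OF frozen(1) *(2-4), of i] *(5) by (simp only: *(1) y' fst_conv snd_conv)
  next
    fix i assume i: "i \<in> {1..M}" "mid_nbrs n Q (Inner i) \<noteq> {}"
      "i = Max {i \<in> {1..M}. mid_nbrs n Q (Inner i) \<noteq> {}}"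
    have *: "f i = f 1" "1 \<le> f i" "f i < g i" "g i \<le> n" 
      "\<And>j. arrows Q (Inner i) (Mid j) = of_bool (j = g i) - of_bool (j = f i)"
      using inner(2)[OF _ i(1,2)] inner(4)[OF _ i] by (simp_all add: f_def g_def)
    show "y' (Inner i) = y (Inner i) *
        (((\<Prod>k=g i+1..n. Y k) *
           ((\<Sum>j=f 1..n-1. \<Prod>k=0..j. Y k)
            + (\<Prod>k=0..n. Y k) * (\<Sum>j=0..f 1-1. \<Prod>k=0..j. Y k))) /
         ((\<Sum>j=g i+1..n. \<Prod>k=g i+1..<j. Y k)
          + (\<Prod>k=g i+1..n. Y k) * (\<Sum>j=0..g i-1. \<Prod>k=0..j. Y k)))"
      using web.tau_var_wrap[OF frozen(2) *(2-4), of i] *(5) by (simp only: *(1) y' fst_conv snd_conv)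
  next
    fix i assume i: "i \<in> {1..N}" "mid_nbrs n Q (Outer i) \<noteq> {}"
      "i \<noteq> Max {i \<in> {1..N}. mid_nbrs n Q (Outer i) \<noteq> {}}"
    have *: "1 \<le> d i" "d i \<le> e i" "e i \<le> n" 
      "\<And>j. arrows Q (Outer i) (Mid j) = of_bool (j = d i) - of_bool (j = e i)"
      using outer(2)[OF _ i(1,2)] outer(3)[OF _ i] by (simp_all add: d_def e_def)
    show "y' (Outer i) = y (Outer i) *
        (((\<Sum>j=e i..n-1. \<Prod>k=d i+1..j. Y k)
          + (\<Prod>k=d i+1..n. Y k) * (\<Sum>j=0..e i-1. \<Prod>k=0..j. Y k)) /
         ((\<Sum>j=d i+1..n. \<Prod>k=d i+1..<j. Y k)
          + (\<Prod>k=d i+1..n. Y k) * (\<Sum>j=0..d i-1. \<Prod>k=0..j. Y k)))"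
      using web.tau_var_arc[OF frozen(1) *(1-3), of i] *(4) by (simp only: y' fst_conv snd_conv)
  next
    fix i assume i: "i \<in> {1..M}" "mid_nbrs n Q (Inner i) \<noteq> {}"
      "i \<noteq> Max {i \<in> {1..M}. mid_nbrs n Q (Inner i) \<noteq> {}}"
    have *: "1 \<le> f i" "f i \<le> g i" "g i \<le> n" 
      "\<And>j. arrows Q (Inner i) (Mid j) = of_bool (j = f i) - of_bool (j = g i)"
      using inner(2)[OF _ i(1,2)] inner(3)[OF _ i] by (simp_all add: f_def g_def)
    show "y' (Inner i) = y (Inner i) *
        (((\<Sum>j=g i..n-1. \<Prod>k=f i+1..j. Y k)
          + (\<Prod>k=f i+1..n. Y k) * (\<Sum>j=0..g i-1. \<Prod>k=0..j. Y k)) /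
         ((\<Sum>j=f i+1..n. \<Prod>k=f i+1..<j. Y k)
          + (\<Prod>k=f i+1..n. Y k) * (\<Sum>j=0..f i-1. \<Prod>k=0..j. Y k)))"
      using web.tau_var_arc[OF frozen(2) *(1-3), of i] *(4) by (simp only: y' fst_conv snd_conv)
  qed
qed

end
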